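(* Let $V$ be a symplectic vector space of dimension $2n$ as described in the context, and let $p,q$ be positive integers. The functions $I_{l,k}\colon S^pV^*\to\mathbb{R}$, $$I_{l,k}(P)=\mathrm{Tr}\bigl(A_{P,l}^k\bigr),\qquad p-q\le 2l\le p,\quad 1\le k\le\binom{2n+q-1}{q},$$ for general degree $p$, and the functions $J_{k,q}\colon S^pV^*\to\mathbb{R}$, $$J_{k,q}(P)=\mathrm{Tr}\bigl(A_{P,q}^k\bigr),\qquad 2q\ge p,\quad 1\le k\le\binom{2n+q-1}{q},$$ for even degree $p$, are $\mathfrak{sp}(V)$-invariant polynomials on $S^pV^*$ of degree $2k$. The bilinear forms $P\otimes Q\mapsto[P,Q]_p\in\mathbb{R}$ are nondegenerate $\mathfrak{sp}(V)$-invariant skew symmetric $2$-forms on $S^pV^*$ if $p$ is odd, and nondegenerate $\mathfrak{sp}(V)$-invariant symmetric forms on $S^pV^*$ if $p$ is even.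
   Context: $V$ is a real vector space of dimension $2n$ (the cotangent space $T_b^*M$ at a point $b$ of a $2n$-dimensional symplectic manifold $(M,\omega)$) with the structure form $\omega_b\in\Lambda^2(V)$ and a canonical basis $e_1,\dots,e_n,f_1,\dots,f_n$ of $V$, so that $\omega_b=\sum_{i=1}^n e_i\wedge f_i$. $\mathfrak{sp}(V)$ is the Lie algebra of linear endomorphisms of $V$ preserving $\omega_b$, with its natural induced action on all $S^mV^*$. $\mathcal{S}=\bigoplus_{m\ge0}S^mV^*$ is the algebra of polynomials on $V$, elements of $S^mV^*$ being homogeneous polynomials of degree $m$. For $v\in V$, $v(P)$ is the directional derivative of $P\in\mathcal{S}$ along $v$. Define $\widehat\omega\colon\mathcal{S}\otimes\mathcal{S}\to\mathcal{S}\otimes\mathcal{S}$ by $$\widehat\omega(P\otimes Q)=\tfrac12\sum_{i=1}^n\bigl(e_i(P)\otimes f_i(Q)-f_i(P)\otimes e_i(Q)\bigr),$$ and let $\mu\colon\mathcal{S}\otimes\mathcal{S}\to\mathcal{S}$ be the multiplication. The symplectic transvectant of order $r$ ($r\ge0$ an integer) is $[P,Q]_r=\mu(\widehat\omega^{\,r}(P\otimes Q))$; it has degree $\deg P+\deg Q-2r$. For $P\in S^pV^*$ of general degree $p$, put $P_{2l}=[P,P]_{2l}$ and define the linear operator $A_{P,l}\colon S^qV^*\to S^qV^*$ by $A_{P,l}(Q)=[P_{2l},Q]_{p-2l}$, where $q\ge p-2l$. For $P\in S^pV^*$ with $p$ even and $q\ge p/2$, define the linear operator $A_{P,q}\colon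 S^qV^*\to S^qV^*$ by $A_{P,q}(Q)=[P,Q]_{p/2}$. (The operator in $I_{l,k}$ is the first of these, and the operator in $J_{k,q}$ is the second.)
   Formalization: The functions J_{k,q} are shown to be homogeneous of degree k (hence of degree at most 2k), not of degree 2k as stated: A_{P,q} is linear in P, and for n=1, p=2, q=1, k=2, P=xy one gets J(tP)=t²/2. *)

theory Defs
  imports "HOL-Analysis.Analysis" "HOL-Library.Function_Algebras"
begin

text \<open>Pointwise real vector space structure on functions, so that \<open>span\<close>, \<open>independent\<close>,
  \<open>representation\<close> etc. apply to spaces of polynomial functions.\<close>

instantiation "fun" :: (type, real_vector) real_vector
begin

definition scaleR_fun :: "real \<Rightarrow> ('a \<Rightarrow> 'b) \<Rightarrow> 'a \<Rightarrow> 'b" where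
  "scaleR_fun c F = (\<lambda>x. c *\<^sub>R F x)"

instance
  by standard (simp_all add: scaleR_fun_def fun_eq_iff algebra_simps)

end

text \<open>\<open>hom_polys m\<close> is \<open>S\<^sup>mW\<^sup>*\<close> for the ambient space \<open>W\<close>, realised as polynomial functions:
  the span of the \<open>m\<close>-fold products of linear functionals. No topology on \<open>W\<close> is involved.\<close>

definition hom_polys :: "nat \<Rightarrow> ('w::real_vector \<Rightarrow> real) set" where
  "hom_polys m = span {(\<lambda>x. \<Prod>i<m. \<phi> i x) | \<phi>. \<forall>i<m. linear (\<phi> i)}"

definition polys_upto :: "nat \<Rightarrow> ('w::real_vector \<Rightarrow> real) set" where
  "polys_upto d = span (\<Union>m\<le>d. hom_polys m)"

text \<open>Polynomials on a linear subspace \<open>W\<close> of the ambient space; since linear functionals extend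
  from \<open>W\<close>, they are the restrictions of the ambient ones. As usual the zero function
  is homogeneous of every degree.\<close>

definition hom_poly_on :: "'w::real_vector set \<Rightarrow> nat \<Rightarrow> ('w \<Rightarrow> real) \<Rightarrow> bool" where
  "hom_poly_on W d F \<longleftrightarrow> (\<exists>G\<in>hom_polys d. \<forall>x\<in>W. F x = G x)"

definition poly_upto_on :: "'w::real_vector set \<Rightarrow> nat \<Rightarrow> ('w \<Rightarrow> real) \<Rightarrow> bool" where
  "poly_upto_on W d F \<longleftrightarrow> (\<exists>G\<in>polys_upto d. \<forall>x\<in>W. F x = G x)"

definition dir_deriv :: "'w::real_vector \<Rightarrow> ('w \<Rightarrow> real) \<Rightarrow> 'w \<Rightarrow> real" where
  "dir_deriv v P x = deriv (\<lambda>t. P (x + t *\<^sub>R v)) 0"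

text \<open>Trace of a linear endomorphism of a finite-dimensional subspace \<open>W\<close>; \<open>B\<close> is an arbitrary basis
  of \<open>W\<close>, on which the trace does not depend.\<close>

definition trace_on :: "'w::real_vector set \<Rightarrow> ('w \<Rightarrow> 'w) \<Rightarrow> real" where
  "trace_on W A = (let B = (SOME B. independent B \<and> span B = W)
                   in \<Sum>b\<in>B. representation B (A b) b)"

text \<open>A basis \<open>e\<^sub>i, f\<^sub>i\<close> (\<open>i < n\<close>) of the space \<open>V\<close> of type \<open>'v\<close>; the structure form is then
  \<open>\<Sum>\<^sub>i e\<^sub>i \<and> f\<^sub>i\<close>, i.e. the basis is canonical by the choice of \<open>\<omega>\<close>.\<close>

definition symplectic_basis :: "nat \<Rightarrow> (nat \<Rightarrow> 'v::real_vector) \<Rightarrow> (nat \<Rightarrow> 'v) \<Rightarrow> bool" where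
  "symplectic_basis n e f \<longleftrightarrow>
     inj_on e {..<n} \<and> inj_on f {..<n} \<and> e ` {..<n} \<inter> f ` {..<n} = {} \<and>
     independent (e ` {..<n} \<union> f ` {..<n}) \<and> span (e ` {..<n} \<union> f ` {..<n}) = UNIV"

text \<open>The bivector \<open>\<Sum>\<^sub>i e\<^sub>i \<and> f\<^sub>i \<in> \<Lambda>\<^sup>2V\<close>, viewed as a skew form on \<open>V\<^sup>*\<close>.\<close>

definition omega ::
  "nat \<Rightarrow> (nat \<Rightarrow> 'v::real_vector) \<Rightarrow> (nat \<Rightarrow> 'v) \<Rightarrow> ('v \<Rightarrow> real) \<Rightarrow> ('v \<Rightarrow> real) \<Rightarrow> real" where
  "omega n e f \<alpha> \<beta> = (\<Sum>i<n. \<alpha> (e i) * \<beta> (f i) - \<alpha> (f i) * \<beta> (e i))"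

text \<open>\<open>\<omega>\<close> is preserved infinitesimally: \<open>(X \<otimes> 1 + 1 \<otimes> X) \<omega> = 0\<close>.\<close>

definition sp :: "nat \<Rightarrow> (nat \<Rightarrow> 'v::real_vector) \<Rightarrow> (nat \<Rightarrow> 'v) \<Rightarrow> ('v \<Rightarrow> 'v) set" where
  "sp n e f = {X. linear X \<and>
     (\<forall>\<alpha> \<beta>. linear \<alpha> \<and> linear \<beta> \<longrightarrow> omega n e f (\<alpha> \<circ> X) \<beta> + omega n e f \<alpha> (\<beta> \<circ> X) = 0)}"

text \<open>If \<open>X\<close> acts linearly on \<open>W\<close>, the induced action on polynomials on \<open>W\<close> is the derivation
  extending \<open>\<phi> \<mapsto> - \<phi> \<circ> X\<close> on \<open>W\<^sup>*\<close>, that is \<open>(X\<cdot>F)(w) = - dF\<^sub>w(X w)\<close>. It is used for \<open>W = V\<close>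
  and, once more, for \<open>W = S\<^sup>pV\<^sup>*\<close>.\<close>

definition induced_act :: "('w::real_vector \<Rightarrow> 'w) \<Rightarrow> ('w \<Rightarrow> real) \<Rightarrow> 'w \<Rightarrow> real" where
  "induced_act X F = (\<lambda>w. - dir_deriv (X w) F w)"

definition sp_invariant_on ::
  "nat \<Rightarrow> (nat \<Rightarrow> 'v::real_vector) \<Rightarrow> (nat \<Rightarrow> 'v) \<Rightarrow>
   ('v \<Rightarrow> real) set \<Rightarrow> (('v \<Rightarrow> real) \<Rightarrow> real) \<Rightarrow> bool" where
  "sp_invariant_on n e f W F \<longleftrightarrow>
     (\<forall>X\<in>sp n e f. \<forall>P\<in>W. induced_act (induced_act X) F P = 0)"

text \<open>The tensor product of two spaces of polynomials on \<open>V\<close> is realised inside the functions on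
  \<open>V \<times> V\<close>, with \<open>P \<otimes> Q\<close> the function \<open>(x, y) \<mapsto> P(x) Q(y)\<close>. Then \<open>e(P) \<otimes> f(Q)\<close> is obtained by
  applying the directional derivatives along \<open>(0, f)\<close> and \<open>(e, 0)\<close> (see \<open>omega_hat_tensor\<close>),
  and multiplication is restriction to the diagonal.\<close>

definition tensor :: "('v \<Rightarrow> real) \<Rightarrow> ('v \<Rightarrow> real) \<Rightarrow> 'v \<times> 'v \<Rightarrow> real" where
  "tensor P Q = (\<lambda>(x, y). P x * Q y)"

definition omega_hat ::
  "nat \<Rightarrow> (nat \<Rightarrow> 'v::real_vector) \<Rightarrow> (nat \<Rightarrow> 'v) \<Rightarrow> ('v \<times> 'v \<Rightarrow> real) \<Rightarrow> 'v \<times> 'v \<Rightarrow> real" where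
  "omega_hat n e f T = (1/2) *\<^sub>R (\<Sum>i<n. dir_deriv (e i, 0) (dir_deriv (0, f i) T)
                                       - dir_deriv (f i, 0) (dir_deriv (0, e i) T))"

definition diag_mult :: "('v \<times> 'v \<Rightarrow> real) \<Rightarrow> 'v \<Rightarrow> real" where
  "diag_mult T = (\<lambda>x. T (x, x))"

definition transvectant ::
  "nat \<Rightarrow> (nat \<Rightarrow> 'v::real_vector) \<Rightarrow> (nat \<Rightarrow> 'v) \<Rightarrow> nat \<Rightarrow>
   ('v \<Rightarrow> real) \<Rightarrow> ('v \<Rightarrow> real) \<Rightarrow> 'v \<Rightarrow> real" where
  "transvectant n e f r P Q = diag_mult ((omega_hat n e f ^^ r) (tensor P Q))"

definition A_l ::
  "nat \<Rightarrow> (nat \<Rightarrow> 'v::real_vector) \<Rightarrow> (nat \<Rightarrow> 'v) \<Rightarrow> nat \<Rightarrow> nat \<Rightarrow>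
   ('v \<Rightarrow> real) \<Rightarrow> ('v \<Rightarrow> real) \<Rightarrow> ('v \<Rightarrow> real)" where
  "A_l n e f p l P Q = transvectant n e f (p - 2 * l) (transvectant n e f (2 * l) P P) Q"

definition A_half ::
  "nat \<Rightarrow> (nat \<Rightarrow> 'v::real_vector) \<Rightarrow> (nat \<Rightarrow> 'v) \<Rightarrow> nat \<Rightarrow>
   ('v \<Rightarrow> real) \<Rightarrow> ('v \<Rightarrow> real) \<Rightarrow> ('v \<Rightarrow> real)" where
  "A_half n e f p P Q = transvectant n e f (p div 2) P Q"

text \<open>\<open>A_l\<close> is quadratic in \<open>P\<close> and \<open>A_half\<close> is linear in \<open>P\<close>, so the traces of the \<open>k\<close>-th powers
  have degrees \<open>2k\<close> and \<open>k\<close> respectively.\<close>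

definition I_inv ::
  "nat \<Rightarrow> (nat \<Rightarrow> 'v::real_vector) \<Rightarrow> (nat \<Rightarrow> 'v) \<Rightarrow> nat \<Rightarrow> nat \<Rightarrow> nat \<Rightarrow> nat \<Rightarrow>
   ('v \<Rightarrow> real) \<Rightarrow> real" where
  "I_inv n e f p q l k P = trace_on (hom_polys q) (A_l n e f p l P ^^ k)"

definition J_inv ::
  "nat \<Rightarrow> (nat \<Rightarrow> 'v::real_vector) \<Rightarrow> (nat \<Rightarrow> 'v) \<Rightarrow> nat \<Rightarrow> nat \<Rightarrow> nat \<Rightarrow>
   ('v \<Rightarrow> real) \<Rightarrow> real" where
  "J_inv n e f p q k P = trace_on (hom_polys q) (A_half n e f p P ^^ k)"

text \<open>For \<open>P, Q \<in> S\<^sup>pV\<^sup>*\<close> the transvectant of order \<open>p\<close> lies in \<open>S\<^sup>0V\<^sup>* = \<real>\<close>, i.e. it is a constant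
  function; the number is read off at \<open>0\<close> (see \<open>transvectant_eq_const\<close>).\<close>

definition transvectant_form ::
  "nat \<Rightarrow> (nat \<Rightarrow> 'v::real_vector) \<Rightarrow> (nat \<Rightarrow> 'v) \<Rightarrow> nat \<Rightarrow>
   ('v \<Rightarrow> real) \<Rightarrow> ('v \<Rightarrow> real) \<Rightarrow> real" where
  "transvectant_form n e f p P Q = transvectant n e f p P Q 0"

definition bilinear_on :: "'w::real_vector set \<Rightarrow> ('w \<Rightarrow> 'w \<Rightarrow> real) \<Rightarrow> bool" where
  "bilinear_on W B \<longleftrightarrow>
     (\<forall>x\<in>W. \<forall>y\<in>W. \<forall>z\<in>W. \<forall>a b.
        B (a *\<^sub>R x + b *\<^sub>R y) z = a * B x z + b * B y z \<and>
        B z (a *\<^sub>R x + b *\<^sub>R y) = a * B z x + b * B z y)"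

definition nondegenerate_on :: "'w::real_vector set \<Rightarrow> ('w \<Rightarrow> 'w \<Rightarrow> real) \<Rightarrow> bool" where
  "nondegenerate_on W B \<longleftrightarrow>
     (\<forall>x\<in>W. (\<forall>y\<in>W. B x y = 0) \<longrightarrow> x = 0) \<and> (\<forall>y\<in>W. (\<forall>x\<in>W. B x y = 0) \<longrightarrow> y = 0)"

definition symmetric_on :: "'w set \<Rightarrow> ('w \<Rightarrow> 'w \<Rightarrow> real) \<Rightarrow> bool" where
  "symmetric_on W B \<longleftrightarrow> (\<forall>x\<in>W. \<forall>y\<in>W. B x y = B y x)"

definition skew_symmetric_on :: "'w set \<Rightarrow> ('w \<Rightarrow> 'w \<Rightarrow> real) \<Rightarrow> bool" where
  "skew_symmetric_on W B \<longleftrightarrow> (\<forall>x\<in>W. \<forall>y\<in>W. B x y = - B y x)"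

definition sp_invariant_form_on ::
  "nat \<Rightarrow> (nat \<Rightarrow> 'v::real_vector) \<Rightarrow> (nat \<Rightarrow> 'v) \<Rightarrow>
   ('v \<Rightarrow> real) set \<Rightarrow> (('v \<Rightarrow> real) \<Rightarrow> ('v \<Rightarrow> real) \<Rightarrow> real) \<Rightarrow> bool" where
  "sp_invariant_form_on n e f W B \<longleftrightarrow>
     (\<forall>X\<in>sp n e f. \<forall>P\<in>W. \<forall>Q\<in>W. B (induced_act X P) Q + B P (induced_act X Q) = 0)"


subsection \<open>The definitions behave as intended on polynomials\<close>

lemma hom_polys_0: "hom_polys 0 = range (\<lambda>c. (\<lambda>_::'w::real_vector. c::real))"
proof -
  have "hom_polys 0 = span {(\<lambda>_::'w. 1::real)}" unfolding hom_polys_def by simp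
  also have "\<dots> = range (\<lambda>c. c *\<^sub>R (\<lambda>_::'w. 1::real))" by (simp add: span_singleton)
  finally show ?thesis by (simp add: scaleR_fun_def)
qed

lemma zero_in_hom_polys: "(\<lambda>_. 0) \<in> hom_polys m"
proof -
  have "0 \<in> hom_polys m" unfolding hom_polys_def by (rule span_zero)
  then show ?thesis by (simp add: zero_fun_def)
qed

lemma span_induct_mem [consumes 1, case_names base step]:
  assumes "x \<in> span S" "h 0"
    and "\<And>c x y. x \<in> S \<Longrightarrow> y \<in> span S \<Longrightarrow> h y \<Longrightarrow> h (c *\<^sub>R x + y)"
  shows "h x"
proof -
  have "x \<in> span S \<and> h x"
    using assms(1)
    by (induction rule: span_induct_alt)
       (use assms(2,3) in \<open>auto intro: span_zero span_add span_scale span_base\<close>)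
  then show ?thesis ..
qed

lemma linear_mult_hom:
  assumes "linear (\<phi> :: 'w::real_vector \<Rightarrow> real)" "P \<in> hom_polys m"
  shows "(\<lambda>x. P x * \<phi> x) \<in> hom_polys (Suc m)"
  using assms(2) unfolding hom_polys_def[of m]
proof (induction rule: span_induct_alt)
  case base
  show ?case by (simp add: zero_in_hom_polys)
next
  case (step c G P)
  then obtain \<psi> where \<psi>: "G = (\<lambda>x. \<Prod>i<m. \<psi> i x)" "\<forall>i<m. linear (\<psi> i)" by auto
  have "(\<lambda>x. G x * \<phi> x) = (\<lambda>x. \<Prod>i<Suc m. (if i < m then \<psi> i else \<phi>) x)"
    by (auto simp: \<psi> fun_eq_iff)
  then have "(\<lambda>x. G x * \<phi> x) \<in> hom_polys (Suc m)"
    unfolding hom_polys_def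
    by (intro span_base CollectI exI[of _ "\<lambda>i. if i < m then \<psi> i else \<phi>"])
       (use \<psi> assms(1) in auto)
  then have "c *\<^sub>R (\<lambda>x. G x * \<phi> x) + (\<lambda>x. P x * \<phi> x) \<in> hom_polys (Suc m)"
    using step unfolding hom_polys_def by (intro span_add span_scale)
  then show ?case by (simp add: scaleR_fun_def plus_fun_def algebra_simps)
qed

lemma hom_mult_hom:
  assumes "P \<in> hom_polys a" "Q \<in> hom_polys b"
  shows "(\<lambda>x. P x * Q x) \<in> hom_polys (a + b)"
  using assms(2) unfolding hom_polys_def[of b]
proof (induction rule: span_induct_alt)
  case base
  show ?case by (simp add: zero_in_hom_polys)
next
  case (step c G Q)
  then obtain \<psi> where \<psi>: "G = (\<lambda>x. \<Prod>i<b. \<psi> i x)" "\<forall>i<b. linear (\<psi> i)" by auto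
  have "(\<lambda>x. P x * (\<Prod>i<j. \<psi> i x)) \<in> hom_polys (a + j)" if "j \<le> b" for j
    using that
  proof (induction j)
    case (Suc j)
    then show ?case
      using linear_mult_hom[of "\<psi> j" "\<lambda>x. P x * (\<Prod>i<j. \<psi> i x)" "a + j"] \<psi>(2)
      by (simp add: mult.assoc)
  qed (use assms(1) in simp)
  then have "(\<lambda>x. P x * G x) \<in> hom_polys (a + b)" by (simp add: \<psi>)
  then have "c *\<^sub>R (\<lambda>x. P x * G x) + (\<lambda>x. P x * Q x) \<in> hom_polys (a + b)"
    using step unfolding hom_polys_def by (intro span_add span_scale)
  then show ?case by (simp add: scaleR_fun_def plus_fun_def algebra_simps)
qed

lemma hom_polys_deriv:
  assumes "P \<in> hom_polys m"
  obtains P' where "P' \<in> hom_polys (m - 1)"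
    "\<And>x. ((\<lambda>t. P (x + t *\<^sub>R v)) has_field_derivative P' x) (at 0)"
proof -
  have gen: "\<exists>P'. P' \<in> hom_polys (m - 1) \<and> (m = 0 \<longrightarrow> P' = (\<lambda>_. 0)) \<and>
      (\<forall>x. ((\<lambda>t. \<Prod>i<m. \<phi> i (x + t *\<^sub>R v)) has_field_derivative P' x) (at 0))"
    if "\<forall>i<m. linear (\<phi> i)" for m and \<phi> :: "nat \<Rightarrow> 'a \<Rightarrow> real"
    using that
  proof (induction m)
    case 0
    show ?case
      by (rule exI[of _ "\<lambda>_. 0"]) (auto simp: hom_polys_0)
  next
    case (Suc m)
    then obtain P' where P': "P' \<in> hom_polys (m - 1)" "m = 0 \<longrightarrow> P' = (\<lambda>_. 0)"
      "\<And>x. ((\<lambda>t. \<Prod>i<m. \<phi> i (x + t *\<^sub>R v)) has_field_derivative P' x) (at 0)"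
      by auto
    have lin: "linear (\<phi> m)" using Suc.prems by simp
    let ?G = "\<lambda>x. \<Prod>i<m. \<phi> i x"
    let ?R = "\<phi> m v *\<^sub>R ?G + (\<lambda>x. P' x * \<phi> m x)"
    have "?G \<in> hom_polys m"
      unfolding hom_polys_def using Suc.prems by (intro span_base) auto
    moreover have "(\<lambda>x. P' x * \<phi> m x) \<in> hom_polys m"
    proof (cases m)
      case 0
      then show ?thesis using P'(2) by (auto simp: hom_polys_0)
    next
      case (Suc j)
      then show ?thesis using linear_mult_hom[OF lin P'(1)] by simp
    qed
    ultimately have "?R \<in> hom_polys m"
      unfolding hom_polys_def by (intro span_add span_scale)
    moreover have "((\<lambda>t. \<Prod>i<Suc m. \<phi> i (x + t *\<^sub>R v)) has_field_derivative ?R x) (at 0)" for x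
    proof -
      have "((\<lambda>t. \<phi> m x + t * \<phi> m v) has_field_derivative \<phi> m v) (at 0)"
        by (auto intro!: derivative_eq_intros)
      then have "((\<lambda>t. \<phi> m (x + t *\<^sub>R v)) has_field_derivative \<phi> m v) (at 0)"
        by (simp add: linear_add[OF lin] linear_scale[OF lin])
      from DERIV_mult[OF P'(3)[of x] this] show ?thesis
        by (simp add: scaleR_fun_def algebra_simps)
    qed
    ultimately show ?case
      by (intro exI[of _ ?R] conjI impI allI) (simp_all only: diff_Suc_1 nat.distinct)
  qed
  have "\<exists>P'. P' \<in> hom_polys (m - 1) \<and>
      (\<forall>x. ((\<lambda>t. P (x + t *\<^sub>R v)) has_field_derivative P' x) (at 0))"
    using assms unfolding hom_polys_def[of m]
  proof (induction rule: span_induct_alt)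
    case base
    show ?case
      by (rule exI[of _ "\<lambda>_. 0"]) (auto simp: zero_in_hom_polys)
  next
    case (step c G P)
    then obtain \<phi> where \<phi>: "G = (\<lambda>x. \<Prod>i<m. \<phi> i x)" "\<forall>i<m. linear (\<phi> i)" by auto
    from gen[OF \<phi>(2)] obtain G' where G': "G' \<in> hom_polys (m - 1)"
      "\<And>x. ((\<lambda>t. G (x + t *\<^sub>R v)) has_field_derivative G' x) (at 0)"
      unfolding \<phi>(1) by blast
    from step obtain P' where P': "P' \<in> hom_polys (m - 1)"
      "\<And>x. ((\<lambda>t. P (x + t *\<^sub>R v)) has_field_derivative P' x) (at 0)"
      by blast
    have "c *\<^sub>R G' + P' \<in> hom_polys (m - 1)"
      using G' P' unfolding hom_polys_def by (intro span_add span_scale)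
    moreover have "((\<lambda>t. (c *\<^sub>R G + P) (x + t *\<^sub>R v)) has_field_derivative (c *\<^sub>R G' + P') x) (at 0)" for x
      by (auto simp: scaleR_fun_def intro!: derivative_eq_intros G' P')
    ultimately show ?case by blast
  qed
  then show thesis using that by blast
qed

lemma dir_deriv_eqI:
  "(\<And>x. ((\<lambda>t. P (x + t *\<^sub>R v)) has_field_derivative P' x) (at 0)) \<Longrightarrow> dir_deriv v P = P'"
  unfolding dir_deriv_def by (auto intro: DERIV_imp_deriv)

lemma dir_deriv_hom: "P \<in> hom_polys m \<Longrightarrow> dir_deriv v P \<in> hom_polys (m - 1)"
  by (metis dir_deriv_eqI hom_polys_deriv)

lemma hom_polys_has_dir_deriv:
  "P \<in> hom_polys m \<Longrightarrow> ((\<lambda>t. P (x + t *\<^sub>R v)) has_field_derivative dir_deriv v P x) (at 0)"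
  by (metis dir_deriv_eqI hom_polys_deriv)

lemma dir_deriv_tensor_left:
  assumes "P \<in> hom_polys a"
  shows "dir_deriv (u, 0) (tensor P Q) = tensor (dir_deriv u P) Q"
proof (rule dir_deriv_eqI, safe)
  fix x y
  show "((\<lambda>t. tensor P Q ((x, y) + t *\<^sub>R (u, 0))) has_field_derivative
      tensor (dir_deriv u P) Q (x, y)) (at 0)"
    using DERIV_cmult_right[OF hom_polys_has_dir_deriv[OF assms, of x u], of "Q y"]
    by (simp add: tensor_def mult.commute)
qed

lemma dir_deriv_tensor_right:
  assumes "Q \<in> hom_polys b"
  shows "dir_deriv (0, u) (tensor P Q) = tensor P (dir_deriv u Q)"
proof (rule dir_deriv_eqI, safe)
  fix x y
  show "((\<lambda>t. tensor P Q ((x, y) + t *\<^sub>R (0, u))) has_field_derivative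
      tensor P (dir_deriv u Q) (x, y)) (at 0)"
    using DERIV_cmult[OF hom_polys_has_dir_deriv[OF assms, of y u], of "P x"]
    by (simp add: tensor_def)
qed

lemma omega_hat_tensor:
  assumes "P \<in> hom_polys a" "Q \<in> hom_polys b"
  shows "omega_hat n e f (tensor P Q) =
    (1/2) *\<^sub>R (\<Sum>i<n. tensor (dir_deriv (e i) P) (dir_deriv (f i) Q)
                     - tensor (dir_deriv (f i) P) (dir_deriv (e i) Q))"
  using assms by (simp add: omega_hat_def dir_deriv_tensor_right dir_deriv_tensor_left)

definition tensors :: "nat \<Rightarrow> nat \<Rightarrow> ('v::real_vector \<times> 'v \<Rightarrow> real) set" where
  "tensors a b = span {tensor P Q | P Q. P \<in> hom_polys a \<and> Q \<in> hom_polys b}"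

lemma tensors_has_dir_deriv:
  assumes "T \<in> tensors a b"
  shows "((\<lambda>t. T (z + t *\<^sub>R w)) has_field_derivative dir_deriv w T z) (at 0)"
proof -
  have "(\<lambda>t. T (z + t *\<^sub>R w)) field_differentiable (at 0)"
    using assms unfolding tensors_def
  proof (induction rule: span_induct_alt)
    case base
    show ?case by simp
  next
    case (step c G T)
    then obtain P Q where PQ: "G = tensor P Q" "P \<in> hom_polys a" "Q \<in> hom_polys b" by auto
    have "(\<lambda>t. P (fst z + t *\<^sub>R fst w)) field_differentiable (at 0)"
      "(\<lambda>t. Q (snd z + t *\<^sub>R snd w)) field_differentiable (at 0)"
      using hom_polys_has_dir_deriv PQ(2,3) unfolding field_differentiable_def by blast+
    from field_differentiable_mult[OF this]
    have "(\<lambda>t. G (z + t *\<^sub>R w)) field_differentiable (at 0)"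
      by (simp add: PQ(1) tensor_def case_prod_unfold)
    from field_differentiable_add[OF field_differentiable_mult[OF field_differentiable_const[of c] this] step(2)]
    show ?case by (simp add: scaleR_fun_def)
  qed
  then show ?thesis
    unfolding dir_deriv_def by (simp add: field_differentiable_derivI)
qed

lemma dir_deriv_comb:
  assumes "S \<in> tensors a b" "T \<in> tensors a b"
  shows "dir_deriv w (c *\<^sub>R S + T) = c *\<^sub>R dir_deriv w S + dir_deriv w T"
  by (rule dir_deriv_eqI)
     (auto simp: scaleR_fun_def intro!: derivative_eq_intros tensors_has_dir_deriv assms)

lemma dir_deriv_zero: "dir_deriv w 0 = 0"
  by (simp add: dir_deriv_def fun_eq_iff)

lemma dir_deriv_tensors_left:
  assumes "T \<in> tensors a b"
  shows "dir_deriv (u, 0) T \<in> tensors (a - 1) b"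
  using assms unfolding tensors_def[of a b]
proof (induction rule: span_induct_mem)
  case base
  show ?case unfolding dir_deriv_zero tensors_def by (rule span_zero)
next
  case (step c G T)
  then obtain P Q where PQ: "G = tensor P Q" "P \<in> hom_polys a" "Q \<in> hom_polys b" by auto
  have "dir_deriv (u, 0) G \<in> tensors (a - 1) b"
    unfolding PQ(1) dir_deriv_tensor_left[OF PQ(2)] tensors_def
    by (rule span_base) (use PQ dir_deriv_hom in blast)
  moreover have "dir_deriv (u, 0) (c *\<^sub>R G + T) = c *\<^sub>R dir_deriv (u, 0) G + dir_deriv (u, 0) T"
    by (rule dir_deriv_comb[of _ a b])
       (use step in \<open>simp_all add: tensors_def span_base\<close>)
  ultimately show ?case using step(3) unfolding tensors_def by (simp only: span_add span_scale)
qed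

lemma dir_deriv_tensors_right:
  assumes "T \<in> tensors a b"
  shows "dir_deriv (0, u) T \<in> tensors a (b - 1)"
  using assms unfolding tensors_def[of a b]
proof (induction rule: span_induct_mem)
  case base
  show ?case unfolding dir_deriv_zero tensors_def by (rule span_zero)
next
  case (step c G T)
  then obtain P Q where PQ: "G = tensor P Q" "P \<in> hom_polys a" "Q \<in> hom_polys b" by auto
  have "dir_deriv (0, u) G \<in> tensors a (b - 1)"
    unfolding PQ(1) dir_deriv_tensor_right[OF PQ(3)] tensors_def
    by (rule span_base) (use PQ dir_deriv_hom in blast)
  moreover have "dir_deriv (0, u) (c *\<^sub>R G + T) = c *\<^sub>R dir_deriv (0, u) G + dir_deriv (0, u) T"
    by (rule dir_deriv_comb[of _ a b])
       (use step in \<open>simp_all add: tensors_def span_base\<close>)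
  ultimately show ?case using step(3) unfolding tensors_def by (simp only: span_add span_scale)
qed

lemma omega_hat_tensors:
  "T \<in> tensors a b \<Longrightarrow> omega_hat n e f T \<in> tensors (a - 1) (b - 1)"
  unfolding omega_hat_def
  using dir_deriv_tensors_left dir_deriv_tensors_right tensors_def
  by (metis (no_types, lifting) span_diff span_scale span_sum)

lemma omega_hat_pow_tensors:
  "T \<in> tensors a b \<Longrightarrow> (omega_hat n e f ^^ r) T \<in> tensors (a - r) (b - r)"
proof (induction r)
  case (Suc r)
  then show ?case using omega_hat_tensors[of _ "a - r" "b - r"] by simp
qed simp

lemma diag_mult_tensors: "T \<in> tensors a b \<Longrightarrow> diag_mult T \<in> hom_polys (a + b)"
  unfolding tensors_def
proof (induction rule: span_induct_mem)
  case base
  show ?case by (simp add: diag_mult_def zero_in_hom_polys)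
next
  case (step c G T)
  then obtain P Q where PQ: "G = tensor P Q" "P \<in> hom_polys a" "Q \<in> hom_polys b" by auto
  have "diag_mult G \<in> hom_polys (a + b)"
    using hom_mult_hom[OF PQ(2,3)] by (simp add: PQ(1) diag_mult_def tensor_def)
  moreover have "diag_mult (c *\<^sub>R G + T) = c *\<^sub>R diag_mult G + diag_mult T"
    by (auto simp: diag_mult_def scaleR_fun_def)
  ultimately show ?case using step(3) unfolding hom_polys_def by (simp only: span_add span_scale)
qed

lemma transvectant_hom:
  assumes "P \<in> hom_polys p" "Q \<in> hom_polys q" "r \<le> p" "r \<le> q"
  shows "transvectant n e f r P Q \<in> hom_polys (p + q - 2 * r)"
proof -
  have "tensor P Q \<in> tensors p q"
    unfolding tensors_def using assms by (intro span_base) auto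
  from diag_mult_tensors[OF omega_hat_pow_tensors[OF this, where n=n and e=e and f=f and r=r]]
  have "transvectant n e f r P Q \<in> hom_polys ((p - r) + (q - r))"
    by (simp add: transvectant_def)
  also have "(p - r) + (q - r) = p + q - 2 * r" using assms by simp
  finally show ?thesis .
qed

lemma A_l_hom:
  assumes "P \<in> hom_polys p" "Q \<in> hom_polys q" "p \<le> q + 2 * l" "2 * l \<le> p"
  shows "A_l n e f p l P Q \<in> hom_polys q"
proof -
  have "transvectant n e f (2 * l) P P \<in> hom_polys (p + p - 2 * (2 * l))"
    using assms by (intro transvectant_hom) auto
  from transvectant_hom[OF this assms(2), of "p - 2 * l"]
  have "A_l n e f p l P Q \<in> hom_polys (p + p - 2 * (2 * l) + q - 2 * (p - 2 * l))"
    using assms by (simp add: A_l_def)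
  also have "p + p - 2 * (2 * l) + q - 2 * (p - 2 * l) = q" using assms by simp
  finally show ?thesis .
qed

lemma A_half_hom:
  assumes "P \<in> hom_polys p" "Q \<in> hom_polys q" "even p" "p \<le> 2 * q"
  shows "A_half n e f p P Q \<in> hom_polys q"
  using transvectant_hom[OF assms(1,2), of "p div 2" n e f] assms
  by (auto simp: A_half_def elim!: evenE)

lemma transvectant_eq_const:
  assumes "P \<in> hom_polys p" "Q \<in> hom_polys p"
  shows "transvectant n e f p P Q = (\<lambda>_. transvectant_form n e f p P Q)"
  using transvectant_hom[OF assms, of p n e f] by (auto simp: hom_polys_0 transvectant_form_def)

end

theory Submission
  imports Defs
begin

text \<open>
  Differentiating \<open>P \<otimes> Q\<close> once before applying the remaining power of \<open>omega_hat\<close> gives the recursion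
  (\<open>transvectant_Suc\<close>)
  \<open>[P, Q]\<^sub>r\<^sub>+\<^sub>1 = 1/2 \<Sum>\<^sub>i ([e\<^sub>i P, f\<^sub>i Q]\<^sub>r - [f\<^sub>i P, e\<^sub>i Q]\<^sub>r)\<close>, \<open>[P, Q]\<^sub>0 = P Q\<close>.
  By induction on \<open>r\<close> it shows that transvectants are bilinear, that \<open>[Q, P]\<^sub>r = (-1)\<^sup>r [P, Q]\<^sub>r\<close>,
  and that they are equivariant, \<open>X[P, Q]\<^sub>r = [X P, Q]\<^sub>r + [P, X Q]\<^sub>r\<close> for \<open>X \<in> sp\<close>
  (\<open>induced_act_transvectant\<close>).

  For \<open>r = p\<close> this gives the symmetry and the invariance of the form, as \<open>[P, Q]\<^sub>p\<close> is constant.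
  Nondegeneracy comes from the test polynomials \<open>\<phi>\<^sup>p\<close> with \<open>\<phi>\<close> a linear functional:
  \<open>[P, \<phi>\<^sup>p]\<^sub>p = (p!)\<^sup>2 / 2\<^sup>p P(w)\<close>, where \<open>w\<close> is the vector corresponding to \<open>\<phi>\<close> under \<open>\<omega>\<close>
  (\<open>transvectant_power\<close>, \<open>dir_deriv_funpow_self\<close>). Every \<open>w \<in> V\<close> arises in this way.

  The operators \<open>A\<^sub>P\<close> on \<open>S\<^sup>qV\<^sup>*\<close> have matrix entries that are homogeneous of degree \<open>d\<close> in \<open>P\<close>, with
  \<open>d = 2\<close> for \<open>A_l\<close> and \<open>d = 1\<close> for \<open>A_half\<close>, so the trace of \<open>A\<^sub>P\<^sup>k\<close> is homogeneous of degree \<open>d k\<close>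
  (\<open>hom_poly_on_trace_funpow\<close>). By equivariance, the derivative of \<open>A\<^sub>P\<close> along \<open>X\<cdot>P\<close> is
  the commutator \<open>[X, A\<^sub>P]\<close>. Hence that of \<open>A\<^sub>P\<^sup>k\<close> is \<open>[X, A\<^sub>P\<^sup>k]\<close>, which has trace \<open>0\<close>
  (\<open>trace_funpow_deriv_zero\<close>).
\<close>

section \<open>Coordinates on a finite-dimensional subspace\<close>

text \<open>Linearity of a map on a subspace; nothing is required outside \<open>U\<close>. This is needed because
  \<open>dir_deriv\<close>, and everything built from it, is linear on polynomials only.\<close>

definition linear_restricted :: "'w::real_vector set \<Rightarrow> ('w \<Rightarrow> 'u::real_vector) \<Rightarrow> bool" where
  "linear_restricted U A \<longleftrightarrow>
     (\<forall>x\<in>U. \<forall>y\<in>U. \<forall>c. A (c *\<^sub>R x + y) = c *\<^sub>R A x + A y)"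

text \<open>Linear endomorphisms of a subspace.\<close>

definition endo_on :: "'w::real_vector set \<Rightarrow> ('w \<Rightarrow> 'w) \<Rightarrow> bool" where
  "endo_on U A \<longleftrightarrow> (\<forall>x\<in>U. A x \<in> U) \<and> linear_restricted U A"

lemma linear_restricted_sum:
  assumes "subspace U" "linear_restricted U A" "\<And>b. b \<in> B \<Longrightarrow> g b \<in> U"
  shows "A (\<Sum>b\<in>B. c b *\<^sub>R g b) = (\<Sum>b\<in>B. c b *\<^sub>R A (g b))"
proof -
  have "0 \<in> U" using assms(1) by (rule subspace_0)
  then have "A (1 *\<^sub>R 0 + 0) = 1 *\<^sub>R A 0 + A 0"
    using assms(2) unfolding linear_restricted_def by blast
  then have A0: "A 0 = 0" by simp
  show ?thesis
    using assms(3)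
  proof (induction B rule: infinite_finite_induct)
    case (insert b B)
    have "(\<Sum>b\<in>B. c b *\<^sub>R g b) \<in> U"
      using insert.prems assms(1) by (intro subspace_sum subspace_scale) auto
    then show ?case
      using insert assms(2) by (simp add: linear_restricted_def)
  qed (simp_all add: A0)
qed

text \<open>Coordinates on a finite-dimensional subspace \<open>U\<close>: a finite set \<open>B \<subseteq> U\<close> together with
  functionals \<open>\<gamma> b\<close> by which the elements of \<open>U\<close> are expanded in \<open>B\<close> and traces on \<open>U\<close> are
  computed. The functionals are linear on the whole ambient space and not only on \<open>U\<close>, so
  that polynomials in them belong to \<open>hom_polys\<close>.\<close>

definition coordinates_on :: "'w::real_vector set \<Rightarrow> 'w set \<Rightarrow> ('w \<Rightarrow> 'w \<Rightarrow> real) \<Rightarrow> bool" where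
  "coordinates_on U B \<gamma> \<longleftrightarrow> finite B \<and> B \<subseteq> U \<and> (\<forall>b. linear (\<gamma> b)) \<and>
     (\<forall>x\<in>U. x = (\<Sum>b\<in>B. \<gamma> b x *\<^sub>R b)) \<and>
     (\<forall>A. (\<forall>x\<in>U. A x \<in> U) \<longrightarrow> trace_on U A = (\<Sum>b\<in>B. \<gamma> b (A b)))"

lemma coordinates_onD:
  assumes "coordinates_on U B \<gamma>"
  shows "finite B" "B \<subseteq> U" "\<And>b. linear (\<gamma> b)"
    "\<And>x. x \<in> U \<Longrightarrow> x = (\<Sum>b\<in>B. \<gamma> b x *\<^sub>R b)"
    "\<And>A. (\<forall>x\<in>U. A x \<in> U) \<Longrightarrow> trace_on U A = (\<Sum>b\<in>B. \<gamma> b (A b))"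
  using assms unfolding coordinates_on_def by blast+

lemma subspace_coordinates:
  fixes U :: "'w::real_vector set"
  assumes "subspace U" "finite S" "U \<subseteq> span S"
  obtains B \<gamma> where "coordinates_on U B \<gamma>"
proof -
  define B where "B = (SOME B. independent B \<and> span B = U)"
  obtain B' where "B' \<subseteq> U" "independent B'" "U \<subseteq> span B'"
    using maximal_independent_subset by blast
  then have "independent B' \<and> span B' = U"
    using assms(1) span_minimal by blast
  then have B: "independent B" "span B = U"
    unfolding B_def by (metis (mono_tags, lifting) someI)+
  have BU: "B \<subseteq> U" using B(2) span_superset by blast
  then have fin: "finite B"
    using independent_span_bound[OF assms(2) B(1)] assms(3) by blast
  define \<gamma> where "\<gamma> b x = representation (extend_basis B) x b" for b x
  \<comment> \<open>The coordinates extend to the ambient space because \<open>B\<close> extends to a basis of it.\<close>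
  have ext: "independent (extend_basis B)" "B \<subseteq> extend_basis B" "span (extend_basis B) = UNIV"
    using independent_extend_basis extend_basis_superset span_extend_basis B(1) by blast+
  have rep: "\<gamma> b x = representation B x b" if "x \<in> U" for b x
    unfolding \<gamma>_def using representation_extend[OF ext(1) _ ext(2)] that B(2) by metis
  have lin: "linear (\<gamma> b)" for b
    unfolding \<gamma>_def
    by (rule linearI) (simp_all add: representation_add representation_scale ext)
  have x: "x = (\<Sum>b\<in>B. \<gamma> b x *\<^sub>R b)" if "x \<in> U" for x
    using sum_representation_eq[OF B(1) _ fin, of x] that B(2) rep[OF that] by simp
  have tr: "trace_on U A = (\<Sum>b\<in>B. \<gamma> b (A b))" if "\<forall>x\<in>U. A x \<in> U" for A
    unfolding trace_on_def B_def[symmetric] Let_def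
    using that BU by (intro sum.cong) (auto simp: rep subset_iff)
  have "coordinates_on U B \<gamma>"
    unfolding coordinates_on_def using fin BU lin x tr by blast
  then show thesis by (rule that)
qed

lemma linear_restricted_coordinates:
  assumes "coordinates_on U B \<gamma>" "subspace U" "linear_restricted U A" "x \<in> U"
  shows "A x = (\<Sum>b\<in>B. \<gamma> b x *\<^sub>R A b)"
proof -
  have "A x = A (\<Sum>b\<in>B. \<gamma> b x *\<^sub>R b)"
    using coordinates_onD(4)[OF assms(1,4)] by (rule arg_cong)
  also have "\<dots> = (\<Sum>b\<in>B. \<gamma> b x *\<^sub>R A b)"
    using coordinates_onD(2)[OF assms(1)] by (intro linear_restricted_sum[OF assms(2,3)]) auto
  finally show ?thesis .
qed

section \<open>Polynomial functions on a subspace\<close>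

lemma scaleR_fun_apply: "(c *\<^sub>R F) x = c *\<^sub>R F x"
  by (simp add: scaleR_fun_def)

lemma sum_fun_apply: "(\<Sum>i\<in>I. F i) x = (\<Sum>i\<in>I. F i x)"
  for F :: "'i \<Rightarrow> 'a \<Rightarrow> 'b::comm_monoid_add"
  by (induction I rule: infinite_finite_induct) auto

lemma subspace_hom_polys: "subspace (hom_polys m)"
  unfolding hom_polys_def by (rule subspace_span)

lemma linear_in_hom_polys_1: "linear \<phi> \<Longrightarrow> \<phi> \<in> hom_polys 1"
  using linear_mult_hom[of \<phi> "\<lambda>_. 1" 0] by (simp add: hom_polys_0)

lemma hom_poly_on_const: "hom_poly_on W 0 (\<lambda>_. c)"
  unfolding hom_poly_on_def by (rule bexI[of _ "\<lambda>_. c"]) (auto simp: hom_polys_0)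

lemma hom_poly_on_mult:
  assumes "hom_poly_on W a F" "hom_poly_on W b G"
  shows "hom_poly_on W (a + b) (\<lambda>x. F x * G x)"
proof -
  obtain F' G' where "F' \<in> hom_polys a" "\<forall>x\<in>W. F x = F' x" "G' \<in> hom_polys b" "\<forall>x\<in>W. G x = G' x"
    using assms unfolding hom_poly_on_def by blast
  then show ?thesis
    unfolding hom_poly_on_def by (intro bexI[of _ "\<lambda>x. F' x * G' x"] hom_mult_hom) auto
qed

lemma hom_poly_on_sum:
  assumes "\<And>i. i \<in> I \<Longrightarrow> hom_poly_on W d (F i)"
  shows "hom_poly_on W d (\<lambda>x. \<Sum>i\<in>I. F i x)"
proof -
  obtain G where G: "\<And>i. i \<in> I \<Longrightarrow> G i \<in> hom_polys d" "\<And>i x. i \<in> I \<Longrightarrow> x \<in> W \<Longrightarrow> F i x = G i x"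
    using assms unfolding hom_poly_on_def by metis
  have "(\<Sum>i\<in>I. G i) \<in> hom_polys d"
    using G(1) subspace_hom_polys by (intro subspace_sum) auto
  then show ?thesis
    unfolding hom_poly_on_def using G(2)
    by (intro bexI[of _ "\<Sum>i\<in>I. G i"]) (auto simp: sum_fun_apply)
qed

lemma hom_poly_on_cong:
  "hom_poly_on W d F \<Longrightarrow> (\<And>x. x \<in> W \<Longrightarrow> F x = G x) \<Longrightarrow> hom_poly_on W d G"
  unfolding hom_poly_on_def by auto

lemma hom_poly_on_linear: "linear \<phi> \<Longrightarrow> hom_poly_on W 1 \<phi>"
  unfolding hom_poly_on_def using linear_in_hom_polys_1 by blast

lemma hom_poly_on_cmult: "hom_poly_on W d F \<Longrightarrow> hom_poly_on W d (\<lambda>x. F x * c)"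
  using hom_poly_on_mult[OF _ hom_poly_on_const] by fastforce

lemma hom_poly_on_linear_restricted:
  fixes W :: "'w::real_vector set" and F :: "'w \<Rightarrow> real"
  assumes "subspace W" "finite S" "W \<subseteq> span S" "linear_restricted W F"
  shows "hom_poly_on W 1 F"
proof -
  obtain B \<gamma> where co: "coordinates_on W B \<gamma>"
    using subspace_coordinates[OF assms(1-3)] .
  note B = coordinates_onD[OF co]
  have "hom_poly_on W 1 (\<lambda>x. \<Sum>b\<in>B. \<gamma> b x * F b)"
    by (intro hom_poly_on_sum hom_poly_on_cmult hom_poly_on_linear B)
  moreover have "(\<Sum>b\<in>B. \<gamma> b x * F b) = F x" if "x \<in> W" for x
    using linear_restricted_coordinates[OF co assms(1,4) that] by simp
  ultimately show ?thesis by (rule hom_poly_on_cong)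
qed

lemma hom_poly_on_quadratic:
  fixes W :: "'w::real_vector set" and \<beta> :: "'w \<Rightarrow> 'w \<Rightarrow> real"
  assumes "subspace W" "finite S" "W \<subseteq> span S"
    and "\<And>x. x \<in> W \<Longrightarrow> linear_restricted W (\<beta> x)"
    and "\<And>y. y \<in> W \<Longrightarrow> linear_restricted W (\<lambda>x. \<beta> x y)"
  shows "hom_poly_on W 2 (\<lambda>x. \<beta> x x)"
proof -
  obtain B \<gamma> where co: "coordinates_on W B \<gamma>"
    using subspace_coordinates[OF assms(1-3)] .
  note B = coordinates_onD[OF co]
  have "hom_poly_on W (1 + 1) (\<lambda>x. \<Sum>b\<in>B. \<gamma> b x * \<beta> x b)"
    by (intro hom_poly_on_sum hom_poly_on_mult hom_poly_on_linear
        hom_poly_on_linear_restricted[OF assms(1-3)] assms(5) B) (use B(2) in auto)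
  moreover have "(\<Sum>b\<in>B. \<gamma> b x * \<beta> x b) = \<beta> x x" if "x \<in> W" for x
    using linear_restricted_coordinates[OF co assms(1) assms(4)[OF that] that] by simp
  ultimately show ?thesis unfolding one_add_one by (rule hom_poly_on_cong)
qed

section \<open>Traces of powers\<close>

lemma endo_on_funpow: "endo_on U A \<Longrightarrow> x \<in> U \<Longrightarrow> (A ^^ k) x \<in> U"
  by (induction k) (auto simp: endo_on_def)

lemma linear_restricted_funpow: "endo_on U A \<Longrightarrow> linear_restricted U (A ^^ k)"
proof (induction k)
  case (Suc k)
  then show ?case
    using endo_on_funpow[OF Suc.prems, of _ k] by (auto simp: endo_on_def linear_restricted_def)
qed (simp add: linear_restricted_def)

text \<open>The matrix of \<open>A\<^sup>k\<^sup>+\<^sup>1\<close> is the product of the matrices of \<open>A\<close> and \<open>A\<^sup>k\<close>.\<close>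

lemma funpow_Suc_coordinates:
  assumes "coordinates_on U B \<gamma>" "subspace U" "endo_on U A" "x \<in> U" "linear \<phi>"
  shows "\<phi> ((A ^^ Suc k) x) = (\<Sum>b\<in>B. \<gamma> b (A x) * \<phi> ((A ^^ k) b) :: real)"
proof -
  have "A x \<in> U" using assms(3,4) by (simp add: endo_on_def)
  then have "(A ^^ k) (A x) = (\<Sum>b\<in>B. \<gamma> b (A x) *\<^sub>R (A ^^ k) b)"
    using linear_restricted_coordinates[OF assms(1,2) linear_restricted_funpow[OF assms(3)]] by blast
  then show ?thesis
    by (simp add: funpow_swap1 linear_sum[OF assms(5)] linear_scale[OF assms(5)])
qed

text \<open>If the entries \<open>\<phi> (A\<^sub>P x)\<close> are homogeneous of degree \<open>d\<close> in \<open>P\<close>, then those of \<open>A\<^sub>P\<^sup>k\<close> are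
  homogeneous of degree \<open>d k\<close>, and the trace is a sum of entries.\<close>

lemma hom_poly_on_trace_funpow:
  fixes U :: "'u::real_vector set" and A :: "'w::real_vector \<Rightarrow> 'u \<Rightarrow> 'u"
  assumes "subspace U" "finite S" "U \<subseteq> span S"
    and endo: "\<And>P. P \<in> W \<Longrightarrow> endo_on U (A P)"
    and entry: "\<And>\<phi> x. linear \<phi> \<Longrightarrow> x \<in> U \<Longrightarrow> hom_poly_on W d (\<lambda>P. \<phi> (A P x))"
  shows "hom_poly_on W (d * k) (\<lambda>P. trace_on U (A P ^^ k))"
proof -
  obtain B \<gamma> where co: "coordinates_on U B \<gamma>"
    using subspace_coordinates[OF assms(1-3)] .
  note B = coordinates_onD[OF co]
  have pow: "hom_poly_on W (d * k) (\<lambda>P. \<phi> ((A P ^^ k) x))"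
    if "linear \<phi>" "x \<in> U" for \<phi> :: "'u \<Rightarrow> real" and x
    using that
  proof (induction k arbitrary: x)
    case 0
    show ?case by (simp add: hom_poly_on_const)
  next
    case (Suc k)
    have "hom_poly_on W (d + d * k) (\<lambda>P. \<Sum>b\<in>B. \<gamma> b (A P x) * \<phi> ((A P ^^ k) b))"
      using Suc B(2,3) by (intro hom_poly_on_sum hom_poly_on_mult entry) auto
    then show ?case unfolding mult_Suc_right
      by (rule hom_poly_on_cong)
        (simp only: funpow_Suc_coordinates[OF co assms(1) endo Suc.prems(2,1)])
  qed
  have "hom_poly_on W (d * k) (\<lambda>P. \<Sum>b\<in>B. \<gamma> b ((A P ^^ k) b))"
    using B(2,3) by (intro hom_poly_on_sum pow) auto
  then show ?thesis
    by (rule hom_poly_on_cong) (simp add: B(5) endo_on_funpow[OF endo])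
qed

lemma trace_on_commute:
  assumes "subspace U" "finite S" "U \<subseteq> span S" "endo_on U A" "endo_on U L"
  shows "trace_on U (\<lambda>x. L (A x)) = trace_on U (\<lambda>x. A (L x))"
proof -
  obtain B \<gamma> where co: "coordinates_on U B \<gamma>"
    using subspace_coordinates[OF assms(1-3)] .
  note B = coordinates_onD[OF co]
  have tr: "trace_on U (\<lambda>x. C (D x)) = (\<Sum>b\<in>B. \<Sum>b'\<in>B. \<gamma> b' (D b) * \<gamma> b (C b'))"
    if C: "endo_on U C" and D: "endo_on U D" for C D
  proof -
    have "\<gamma> b (C (D b)) = (\<Sum>b'\<in>B. \<gamma> b' (D b) * \<gamma> b (C b'))" if "b \<in> B" for b
    proof -
      have Db: "D b \<in> U" using D that B(2) by (auto simp: endo_on_def)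
      have "C (D b) = (\<Sum>b'\<in>B. \<gamma> b' (D b) *\<^sub>R C b')"
        using linear_restricted_coordinates[OF co assms(1) _ Db] C by (auto simp: endo_on_def)
      then show ?thesis by (simp add: linear_sum[OF B(3)] linear_scale[OF B(3)])
    qed
    then show ?thesis using C D by (simp add: B(5) endo_on_def)
  qed
  show ?thesis unfolding tr[OF assms(4,5)] tr[OF assms(5,4)]
    by (subst sum.swap) (simp add: mult.commute)
qed

text \<open>If the derivative of a family of endomorphisms at \<open>t = 0\<close> is the commutator \<open>[L, A]\<close>, then that
  of its \<open>k\<close>-th power is \<open>[L, A\<^sup>k]\<close>, and a commutator has trace \<open>0\<close>.\<close>

lemma trace_funpow_deriv_zero:
  fixes U :: "'u::real_vector set" and A :: "real \<Rightarrow> 'u \<Rightarrow> 'u"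
  assumes "subspace U" "finite S" "U \<subseteq> span S"
    and endo: "\<And>t. endo_on U (A t)" and L: "endo_on U L"
    and deriv: "\<And>\<phi> x. linear \<phi> \<Longrightarrow> x \<in> U \<Longrightarrow>
      ((\<lambda>t. \<phi> (A t x)) has_field_derivative \<phi> (L (A 0 x) - A 0 (L x))) (at 0)"
  shows "((\<lambda>t. trace_on U (A t ^^ k)) has_field_derivative 0) (at 0)"
proof -
  obtain B \<gamma> where co: "coordinates_on U B \<gamma>"
    using subspace_coordinates[OF assms(1-3)] .
  note B = coordinates_onD[OF co]
  have Lm: "L x \<in> U" if "x \<in> U" for x using L that by (simp add: endo_on_def)
  have Am: "A 0 x \<in> U" if "x \<in> U" for x using endo that by (simp add: endo_on_def)
  note Apow = endo_on_funpow[OF endo]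
  have pow: "((\<lambda>t. \<phi> ((A t ^^ k) x)) has_field_derivative
      \<phi> (L ((A 0 ^^ k) x) - (A 0 ^^ k) (L x))) (at 0)"
    if "linear \<phi>" "x \<in> U" for \<phi> :: "'u \<Rightarrow> real" and x
    using that
  proof (induction k arbitrary: x)
    case 0
    then show ?case by (simp add: linear_0)
  next
    case (Suc k)
    \<comment> \<open>Leibniz rule for \<open>A\<^sup>k\<^sup>+\<^sup>1 = A\<^sup>k A\<close>; the two terms combine by
      \<open>A\<^sup>k [L, A] + [L, A\<^sup>k] A = [L, A\<^sup>k\<^sup>+\<^sup>1]\<close>.\<close>
    have "((\<lambda>t. \<Sum>b\<in>B. \<gamma> b (A t x) * \<phi> ((A t ^^ k) b)) has_field_derivative
       (\<Sum>b\<in>B. \<gamma> b (L (A 0 x) - A 0 (L x)) * \<phi> ((A 0 ^^ k) b)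
          + \<phi> (L ((A 0 ^^ k) b) - (A 0 ^^ k) (L b)) * \<gamma> b (A 0 x))) (at 0)"
      using Suc B(2,3) by (intro DERIV_sum DERIV_mult deriv Suc.IH) auto
    moreover have "(\<Sum>b\<in>B. \<gamma> b (L (A 0 x) - A 0 (L x)) * \<phi> ((A 0 ^^ k) b)
          + \<phi> (L ((A 0 ^^ k) b) - (A 0 ^^ k) (L b)) * \<gamma> b (A 0 x))
        = \<phi> (L ((A 0 ^^ Suc k) x) - (A 0 ^^ Suc k) (L x))"
    proof -
      note exp = linear_restricted_coordinates[OF co assms(1)]
      have Ak: "linear_restricted U (A 0 ^^ k)" by (rule linear_restricted_funpow[OF endo])
      have com: "linear_restricted U (\<lambda>y. L ((A 0 ^^ k) y) - (A 0 ^^ k) (L y))"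
        using L Ak Apow unfolding linear_restricted_def endo_on_def
        by (simp add: algebra_simps)
      have d: "L (A 0 x) - A 0 (L x) \<in> U"
        using Lm Am Suc.prems(2) assms(1) by (simp add: subspace_diff)
      have "(\<Sum>b\<in>B. \<gamma> b (L (A 0 x) - A 0 (L x)) * \<phi> ((A 0 ^^ k) b)
          + \<phi> (L ((A 0 ^^ k) b) - (A 0 ^^ k) (L b)) * \<gamma> b (A 0 x))
        = \<phi> ((A 0 ^^ k) (L (A 0 x) - A 0 (L x)))
          + \<phi> (L ((A 0 ^^ k) (A 0 x)) - (A 0 ^^ k) (L (A 0 x)))"
        unfolding exp[OF Ak d] exp[OF com Am[OF Suc.prems(2)]]
          linear_sum[OF Suc.prems(1)] linear_scale[OF Suc.prems(1)]
        by (simp add: sum.distrib mult.commute)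
      moreover have "(A 0 ^^ k) (L (A 0 x) - A 0 (L x))
          = (A 0 ^^ k) (L (A 0 x)) - (A 0 ^^ k) (A 0 (L x))"
      proof -
        have "L (A 0 x) - A 0 (L x) = (-1) *\<^sub>R A 0 (L x) + L (A 0 x)" by simp
        also have "(A 0 ^^ k) \<dots> = (-1) *\<^sub>R (A 0 ^^ k) (A 0 (L x)) + (A 0 ^^ k) (L (A 0 x))"
          using Ak Lm Am Suc.prems(2) unfolding linear_restricted_def by blast
        finally show ?thesis by simp
      qed
      ultimately show ?thesis
        by (simp add: funpow_swap1 linear_diff[OF Suc.prems(1)])
    qed
    ultimately show ?case
      by (simp only: funpow_Suc_coordinates[OF co assms(1) endo Suc.prems(2,1)])
  qed
  have "((\<lambda>t. \<Sum>b\<in>B. \<gamma> b ((A t ^^ k) b)) has_field_derivative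
      (\<Sum>b\<in>B. \<gamma> b (L ((A 0 ^^ k) b) - (A 0 ^^ k) (L b)))) (at 0)"
    using B(2,3) by (intro DERIV_sum pow) auto
  moreover have "(\<Sum>b\<in>B. \<gamma> b (L ((A 0 ^^ k) b) - (A 0 ^^ k) (L b))) = 0"
  proof -
    have "endo_on U (A 0 ^^ k)"
      using Apow linear_restricted_funpow[OF endo] by (simp add: endo_on_def)
    from trace_on_commute[OF assms(1-3) this L] show ?thesis
      using Apow Lm by (simp add: B(5) linear_diff[OF B(3)] sum_subtractf)
  qed
  ultimately show ?thesis by (simp add: B(5) Apow)
qed

section \<open>Differential calculus of homogeneous polynomials\<close>

lemma hom_polys_comb:
  "P \<in> hom_polys m \<Longrightarrow> Q \<in> hom_polys m \<Longrightarrow> c *\<^sub>R P + Q \<in> hom_polys m"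
  using subspace_hom_polys by (intro subspace_add subspace_scale)

text \<open>Induction along the construction of a homogeneous polynomial from constants by multiplication
  with linear functionals and linear combinations. The combination step is applied within a single
  degree.\<close>

lemma hom_polys_induct [consumes 1, case_names const mult comb]:
  fixes P :: "'v::real_vector \<Rightarrow> real"
  assumes "P \<in> hom_polys m"
    and const: "\<And>c. R 0 (\<lambda>_. c)"
    and mult: "\<And>m \<phi> P. linear \<phi> \<Longrightarrow> P \<in> hom_polys m \<Longrightarrow> R m P \<Longrightarrow> R (Suc m) (\<lambda>x. P x * \<phi> x)"
    and comb: "\<And>m c P Q. P \<in> hom_polys m \<Longrightarrow> Q \<in> hom_polys m \<Longrightarrow> R m P \<Longrightarrow> R m Q \<Longrightarrow>
      R m (c *\<^sub>R P + Q)"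
  shows "R m P"
  using assms(1) unfolding hom_polys_def
proof (induction rule: span_induct_mem)
  case base
  have "R m (\<lambda>_. 0)"
  proof (induction m)
    case (Suc m)
    have "linear (\<lambda>_::'v. 0::real)" by (rule linearI) auto
    from mult[OF this zero_in_hom_polys Suc] show ?case by simp
  qed (rule const)
  then show ?case by (simp add: zero_fun_def)
next
  case (step c G Q)
  then obtain \<phi> where \<phi>: "G = (\<lambda>x. \<Prod>i<m. \<phi> i x)" "\<forall>i<m. linear (\<phi> i)" by auto
  have "(\<lambda>x. \<Prod>i<j. \<phi> i x) \<in> hom_polys j \<and> R j (\<lambda>x. \<Prod>i<j. \<phi> i x)" if "j \<le> m" for j
    using that
  proof (induction j)
    case 0
    then show ?case using const[of 1] by (auto simp: hom_polys_0)
  next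
    case (Suc j)
    then show ?case using \<phi>(2) mult[of "\<phi> j"] linear_mult_hom[of "\<phi> j"] by simp
  qed
  then have "G \<in> hom_polys m" "R m G" by (auto simp: \<phi>(1))
  moreover have "Q \<in> hom_polys m" using step(2) by (simp only: hom_polys_def)
  ultimately show ?case using comb step(3) by blast
qed

lemma dir_deriv_hom_comb:
  assumes "P \<in> hom_polys m" "Q \<in> hom_polys m"
  shows "dir_deriv v (c *\<^sub>R P + Q) = c *\<^sub>R dir_deriv v P + dir_deriv v Q"
  by (rule dir_deriv_eqI)
     (auto simp: scaleR_fun_def intro!: derivative_eq_intros hom_polys_has_dir_deriv assms)

lemma dir_deriv_const: "dir_deriv v (\<lambda>_. c) = (\<lambda>_. 0)"
  by (rule dir_deriv_eqI) simp

lemma dir_deriv_mult: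
  assumes "P \<in> hom_polys a" "Q \<in> hom_polys b"
  shows "dir_deriv v (\<lambda>x. P x * Q x) = (\<lambda>x. dir_deriv v P x * Q x + P x * dir_deriv v Q x)"
proof (rule dir_deriv_eqI)
  fix x
  show "((\<lambda>t. P (x + t *\<^sub>R v) * Q (x + t *\<^sub>R v)) has_field_derivative
      dir_deriv v P x * Q x + P x * dir_deriv v Q x) (at 0)"
    using DERIV_mult[OF hom_polys_has_dir_deriv[OF assms(1), of x v]
        hom_polys_has_dir_deriv[OF assms(2), of x v]]
    by (simp add: mult.commute add.commute)
qed

lemma dir_deriv_linear:
  fixes \<phi> :: "'v::real_vector \<Rightarrow> real"
  assumes "linear \<phi>"
  shows "dir_deriv v \<phi> = (\<lambda>_. \<phi> v)"
proof (rule dir_deriv_eqI)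
  fix x
  have "((\<lambda>t. \<phi> x + t * \<phi> v) has_field_derivative \<phi> v) (at 0)"
    by (auto intro!: derivative_eq_intros)
  then show "((\<lambda>t. \<phi> (x + t *\<^sub>R v)) has_field_derivative \<phi> v) (at 0)"
    by (simp add: linear_add[OF assms] linear_scale[OF assms])
qed

lemma dir_deriv_mult_linear:
  assumes "P \<in> hom_polys a" "linear \<phi>"
  shows "dir_deriv v (\<lambda>x. P x * \<phi> x) = (\<lambda>x. dir_deriv v P x * \<phi> x + P x * \<phi> v)"
  using dir_deriv_mult[OF assms(1) linear_in_hom_polys_1[OF assms(2)]]
  by (simp add: dir_deriv_linear[OF assms(2)])

lemma linear_dir_deriv:
  assumes "P \<in> hom_polys m"
  shows "linear (\<lambda>v. dir_deriv v P x)"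
  using assms
proof (induction rule: hom_polys_induct)
  case (const c)
  show ?case by (auto simp: dir_deriv_const intro: linearI)
next
  case (mult m \<phi> P)
  show ?case
    unfolding dir_deriv_mult_linear[OF mult(2,1)]
    by (intro linearI)
       (simp_all add: linear_add[OF mult(3)] linear_add[OF mult(1)] linear_scale[OF mult(3)]
          linear_scale[OF mult(1)] algebra_simps)
next
  case (comb m c P Q)
  show ?case
    unfolding dir_deriv_hom_comb[OF comb(1,2)]
    by (intro linearI)
       (simp_all add: scaleR_fun_apply linear_add[OF comb(3)] linear_add[OF comb(4)]
          linear_scale[OF comb(3)] linear_scale[OF comb(4)] algebra_simps)
qed

text \<open>Euler's identity.\<close>

lemma dir_deriv_self:
  "P \<in> hom_polys m \<Longrightarrow> dir_deriv x P x = real m * P x"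
proof (induction rule: hom_polys_induct)
  case (mult m \<phi> P)
  then show ?case by (simp add: dir_deriv_mult_linear algebra_simps)
next
  case (comb m c P Q)
  then show ?case
    unfolding dir_deriv_hom_comb[OF comb(1,2)] by (simp add: scaleR_fun_apply algebra_simps)
qed (simp add: dir_deriv_const)

text \<open>Hence \<open>D\<^sub>w\<^sup>m P\<close> recovers the values of \<open>P\<close>: it is a constant, which iterating Euler's identity
  at the point \<open>w\<close> evaluates to \<open>m! P(w)\<close>.\<close>

lemma dir_deriv_funpow_self:
  assumes "P \<in> hom_polys m"
  shows "(dir_deriv w ^^ m) P = (\<lambda>_. fact m * P w)"
proof -
  have "(dir_deriv w ^^ m) P \<in> hom_polys 0 \<and> ((dir_deriv w ^^ m) P) w = fact m * P w"
    using assms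
  proof (induction m arbitrary: P)
    case (Suc m)
    have "dir_deriv w P \<in> hom_polys m" using dir_deriv_hom[OF Suc.prems] by simp
    from Suc.IH[OF this] show ?case
      by (simp add: funpow_swap1 dir_deriv_self[OF Suc.prems] algebra_simps)
  qed simp
  then show ?thesis by (auto simp: hom_polys_0)
qed

lemma finite_spanning_hom_polys:
  fixes S :: "'v::real_vector set"
  assumes "finite S" "span S = UNIV"
  obtains T :: "('v \<Rightarrow> real) set" where "finite T" "hom_polys m \<subseteq> span T"
proof -
  obtain B \<gamma> where co: "coordinates_on (UNIV::'v set) B \<gamma>"
    using subspace_coordinates[OF subspace_UNIV assms(1)] assms(2) by blast
  note B = coordinates_onD[OF co]
  \<comment> \<open>\<open>T m\<close> is the set of monomials of degree \<open>m\<close> in the coordinate functionals.\<close>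
  define T where "T = rec_nat {\<lambda>_::'v. 1} (\<lambda>_ T'. (\<lambda>(P, b) x. P x * \<gamma> b x) ` (T' \<times> B))"
  have T0: "T 0 = {\<lambda>_. 1}" and TS: "T (Suc m) = (\<lambda>(P, b) x. P x * \<gamma> b x) ` (T m \<times> B)" for m
    by (simp_all add: T_def)
  have "finite (T m)" for m by (induction m) (auto simp: T0 TS B(1))
  moreover have "P \<in> span (T m)" if "P \<in> hom_polys m" for P m
    using that
  proof (induction rule: hom_polys_induct)
    case (const c)
    have "c *\<^sub>R (\<lambda>_::'v. 1::real) \<in> span (T 0)" unfolding T0 by (intro span_scale span_base) simp
    then show ?case by (simp add: scaleR_fun_def)
  next
    case (mult m \<phi> P)
    have Pb: "(\<lambda>x. P x * \<gamma> b x) \<in> span (T (Suc m))" if "b \<in> B" for b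
      using mult.IH
    proof (induction rule: span_induct_mem)
      case base
      have "0 \<in> span (T (Suc m))" by (rule span_zero)
      then show ?case by (simp add: zero_fun_def)
    next
      case (step c G Q)
      have "(\<lambda>x. G x * \<gamma> b x) \<in> span (T (Suc m))"
        unfolding TS using step(1) that by (intro span_base) force
      then have "c *\<^sub>R (\<lambda>x. G x * \<gamma> b x) + (\<lambda>x. Q x * \<gamma> b x) \<in> span (T (Suc m))"
        using step(3) by (intro span_add span_scale)
      then show ?case by (simp add: scaleR_fun_def plus_fun_def algebra_simps)
    qed
    have "linear_restricted UNIV \<phi>"
      using mult.hyps(1) by (simp add: linear_restricted_def linear_add linear_scale)
    note \<phi> = linear_restricted_coordinates[OF co subspace_UNIV this UNIV_I]
    have "(\<lambda>x. P x * \<phi> x) = (\<Sum>b\<in>B. \<phi> b *\<^sub>R (\<lambda>x. P x * \<gamma> b x))"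
    proof
      fix x
      have "P x * \<phi> x = P x * (\<Sum>b\<in>B. \<gamma> b x * \<phi> b)"
        using \<phi>[of x] by (simp only: real_scaleR_def)
      then show "P x * \<phi> x = (\<Sum>b\<in>B. \<phi> b *\<^sub>R (\<lambda>x. P x * \<gamma> b x)) x"
        by (simp add: sum_distrib_left scaleR_fun_apply sum_fun_apply ac_simps)
    qed
    also have "\<dots> \<in> span (T (Suc m))" by (intro span_sum span_scale Pb)
    finally show ?case .
  next
    case (comb m c P Q)
    then show ?case by (intro span_add span_scale)
  qed
  ultimately show thesis using that by blast
qed

section \<open>The induced action of an endomorphism\<close>

lemma induced_act_const: "induced_act X (\<lambda>_. c) = (\<lambda>_. 0)"
  by (simp add: induced_act_def dir_deriv_const)

lemma induced_act_comb:
  assumes "P \<in> hom_polys m" "Q \<in> hom_polys m"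
  shows "induced_act X (c *\<^sub>R P + Q) = c *\<^sub>R induced_act X P + induced_act X Q"
  unfolding induced_act_def dir_deriv_hom_comb[OF assms] by (auto simp: scaleR_fun_apply)

lemma induced_act_mult:
  assumes "P \<in> hom_polys a" "Q \<in> hom_polys b"
  shows "induced_act X (\<lambda>x. P x * Q x) = (\<lambda>x. induced_act X P x * Q x + P x * induced_act X Q x)"
  by (auto simp: induced_act_def dir_deriv_mult[OF assms])

lemma induced_act_linear:
  "linear \<phi> \<Longrightarrow> induced_act X \<phi> = (\<lambda>x. - \<phi> (X x))"
  by (simp add: induced_act_def dir_deriv_linear)

lemma induced_act_mult_linear:
  assumes "P \<in> hom_polys a" "linear \<phi>"
  shows "induced_act X (\<lambda>x. P x * \<phi> x) = (\<lambda>x. induced_act X P x * \<phi> x + P x * - \<phi> (X x))"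
  using induced_act_mult[OF assms(1) linear_in_hom_polys_1[OF assms(2)]]
  by (simp add: induced_act_linear[OF assms(2)])

lemma linear_neg_comp:
  fixes \<phi> :: "'v::real_vector \<Rightarrow> real"
  shows "linear X \<Longrightarrow> linear \<phi> \<Longrightarrow> linear (\<lambda>x. - \<phi> (X x))"
  by (intro linearI) (simp_all add: linear_add linear_scale)

lemma induced_act_hom:
  assumes "linear X" "P \<in> hom_polys m"
  shows "induced_act X P \<in> hom_polys m"
  using assms(2)
proof (induction rule: hom_polys_induct)
  case (mult m \<phi> P)
  have "(1::real) *\<^sub>R (\<lambda>x. induced_act X P x * \<phi> x) + (\<lambda>x. P x * - \<phi> (X x)) \<in> hom_polys (Suc m)"
    using mult by (intro hom_polys_comb linear_mult_hom linear_neg_comp assms(1))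
  then show ?case
    by (simp add: induced_act_mult_linear[OF mult(2,1)] plus_fun_def scaleR_fun_def)
next
  case (comb m c P Q)
  show ?case
    unfolding induced_act_comb[OF comb(1,2)] by (rule hom_polys_comb[OF comb(3,4)])
qed (simp add: induced_act_const zero_in_hom_polys)

text \<open>The commutator of the action of \<open>X\<close> with the derivative along \<open>v\<close> is the derivative
  along \<open>X v\<close>.\<close>

lemma induced_act_dir_deriv:
  assumes "linear X" "P \<in> hom_polys m"
  shows "induced_act X (dir_deriv v P) = dir_deriv v (induced_act X P) + dir_deriv (X v) P"
  using assms(2)
proof (induction rule: hom_polys_induct)
  case (const c)
  show ?case by (simp add: induced_act_const dir_deriv_const fun_eq_iff)
next
  case (comb m c P Q)
  note hom = comb(1,2)
  show ?case
    unfolding dir_deriv_hom_comb[OF hom] induced_act_comb[OF hom]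
      dir_deriv_hom_comb[OF hom[THEN induced_act_hom[OF assms(1)]]]
      induced_act_comb[OF hom[THEN dir_deriv_hom]] comb(3,4)
    by (simp only: scaleR_add_right ac_simps)
next
  case (mult m \<phi> P)
  \<comment> \<open>Both sides are expanded as \<open>D\<^sub>v (P \<phi>) = \<phi>(v) P + (D\<^sub>v P) \<phi>\<close> and \<open>X (P \<phi>) = (X P) \<phi> + P \<psi>\<close>
    with \<open>\<psi> = - \<phi> \<circ> X\<close>; the summands have to be kept homogeneous of one degree for linearity to apply.\<close>
  let ?\<psi> = "\<lambda>x. - \<phi> (X x)"
  let ?D = "\<lambda>x. dir_deriv v P x * \<phi> x"
  have \<psi>: "linear ?\<psi>" by (rule linear_neg_comp[OF assms(1) mult(1)])
  have P\<phi>: "(\<lambda>x. P x * \<phi> x) \<in> hom_polys (Suc m)" by (rule linear_mult_hom[OF mult(1,2)])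
  have D: "dir_deriv v (\<lambda>x. P x * \<phi> x) = \<phi> v *\<^sub>R P + ?D"
    by (auto simp: dir_deriv_mult_linear[OF mult(2,1)] scaleR_fun_def)
  have "?D \<in> hom_polys m"
  proof -
    have "dir_deriv v (\<lambda>x. P x * \<phi> x) \<in> hom_polys m"
      using dir_deriv_hom[OF P\<phi>] by simp
    from hom_polys_comb[OF mult(2) this, of "- \<phi> v"] show ?thesis by (simp add: D)
  qed
  then have e1: "induced_act X (dir_deriv v (\<lambda>x. P x * \<phi> x)) = \<phi> v *\<^sub>R induced_act X P + induced_act X ?D"
    unfolding D by (rule induced_act_comb[OF mult(2)])
  have e2: "induced_act X ?D = (\<lambda>x. induced_act X (dir_deriv v P) x * \<phi> x + dir_deriv v P x * ?\<psi> x)"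
    by (rule induced_act_mult_linear[OF dir_deriv_hom[OF mult(2)] mult(1)])
  have e3: "dir_deriv v (induced_act X (\<lambda>x. P x * \<phi> x))
      = dir_deriv v (\<lambda>x. induced_act X P x * \<phi> x) + dir_deriv v (\<lambda>x. P x * ?\<psi> x)"
  proof -
    have "induced_act X (\<lambda>x. P x * \<phi> x)
        = 1 *\<^sub>R (\<lambda>x. induced_act X P x * \<phi> x) + (\<lambda>x. P x * ?\<psi> x)"
      by (auto simp: induced_act_mult_linear[OF mult(2,1)] scaleR_fun_def)
    moreover have h1: "(\<lambda>x. induced_act X P x * \<phi> x) \<in> hom_polys (Suc m)"
      by (rule linear_mult_hom[OF mult(1) induced_act_hom[OF assms(1) mult(2)]])
    moreover have h2: "(\<lambda>x. P x * ?\<psi> x) \<in> hom_polys (Suc m)"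
      by (rule linear_mult_hom[OF \<psi> mult(2)])
    ultimately show ?thesis using dir_deriv_hom_comb[OF h1 h2, of v 1] by (simp only: scaleR_one)
  qed
  show ?case
    unfolding e1 e2 e3
    unfolding dir_deriv_mult_linear[OF mult(2,1)] dir_deriv_mult_linear[OF mult(2) \<psi>] mult.IH
      dir_deriv_mult_linear[OF induced_act_hom[OF assms(1) mult(2)] mult(1)]
    by (simp add: fun_eq_iff scaleR_fun_apply algebra_simps)
qed

section \<open>Transvectants\<close>

lemma tensor_in_tensors:
  "P \<in> hom_polys a \<Longrightarrow> Q \<in> hom_polys b \<Longrightarrow> tensor P Q \<in> tensors a b"
  unfolding tensors_def by (intro span_base) blast

lemma subspace_tensors: "subspace (tensors a b)"
  unfolding tensors_def by (rule subspace_span)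

lemma linear_restricted_omega_hat: "linear_restricted (tensors a b) (omega_hat n e f)"
proof -
  have "omega_hat n e f (c *\<^sub>R S + T) = c *\<^sub>R omega_hat n e f S + omega_hat n e f T"
    if "S \<in> tensors a b" "T \<in> tensors a b" for c and S T :: "'a \<times> 'a \<Rightarrow> real"
  proof -
    have "dir_deriv (u, 0) (dir_deriv (0, v) (c *\<^sub>R S + T))
        = c *\<^sub>R dir_deriv (u, 0) (dir_deriv (0, v) S) + dir_deriv (u, 0) (dir_deriv (0, v) T)" for u v
      by (simp only: dir_deriv_comb[OF that]
          dir_deriv_comb[OF dir_deriv_tensors_right[OF that(1)] dir_deriv_tensors_right[OF that(2)]])
    then show ?thesis
      by (simp add: omega_hat_def algebra_simps sum.distrib sum_subtractf scaleR_sum_right)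
  qed
  then show ?thesis unfolding linear_restricted_def by blast
qed

lemma linear_restricted_omega_hat_funpow:
  "linear_restricted (tensors a b) (omega_hat n e f ^^ r)"
proof (induction r)
  case (Suc r)
  have "omega_hat n e f (c *\<^sub>R (omega_hat n e f ^^ r) S + (omega_hat n e f ^^ r) T)
      = c *\<^sub>R omega_hat n e f ((omega_hat n e f ^^ r) S) + omega_hat n e f ((omega_hat n e f ^^ r) T)"
    if "S \<in> tensors a b" "T \<in> tensors a b" for c and S T :: "'a \<times> 'a \<Rightarrow> real"
    using linear_restricted_omega_hat[of "a - r" "b - r"] omega_hat_pow_tensors that
    unfolding linear_restricted_def by blast
  then show ?case using Suc by (simp add: linear_restricted_def)
qed (simp add: linear_restricted_def)

lemma transvectant_0: "transvectant n e f 0 P Q = (\<lambda>x. P x * Q x)"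
  by (simp add: transvectant_def diag_mult_def tensor_def)

text \<open>\<open>P \<otimes> Q\<close> is differentiated first and the remaining power of \<open>omega_hat\<close> applied to the result,
  so that statements about transvectants follow by induction on the order for all pairs of
  homogeneous polynomials.\<close>

lemma transvectant_Suc:
  assumes "P \<in> hom_polys a" "Q \<in> hom_polys b"
  shows "transvectant n e f (Suc r) P Q = (1/2) *\<^sub>R
    (\<Sum>i<n. transvectant n e f r (dir_deriv (e i) P) (dir_deriv (f i) Q)
          - transvectant n e f r (dir_deriv (f i) P) (dir_deriv (e i) Q))"
proof -
  let ?T = "tensors (a - 1) (b - 1)" and ?w = "omega_hat n e f ^^ r"
  have mem: "tensor (dir_deriv u P) (dir_deriv v Q) \<in> ?T" for u v
    using assms by (intro tensor_in_tensors dir_deriv_hom)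
  have lin: "?w (c *\<^sub>R S + T) = c *\<^sub>R ?w S + ?w T" if "S \<in> ?T" "T \<in> ?T" for c S T
    using linear_restricted_omega_hat_funpow[of "a - 1" "b - 1"] that
    unfolding linear_restricted_def by blast
  have diff: "?w (S - T) = ?w S - ?w T" if "S \<in> ?T" "T \<in> ?T" for S T
    using lin[OF that(2,1), of "-1"] by simp
  have "?w (omega_hat n e f (tensor P Q))
      = ?w (\<Sum>i<n. (1/2) *\<^sub>R (tensor (dir_deriv (e i) P) (dir_deriv (f i) Q)
                     - tensor (dir_deriv (f i) P) (dir_deriv (e i) Q)))"
    by (simp only: omega_hat_tensor[OF assms] scaleR_sum_right)
  also have "\<dots> = (\<Sum>i<n. (1/2) *\<^sub>R (?w (tensor (dir_deriv (e i) P) (dir_deriv (f i) Q)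
                     - tensor (dir_deriv (f i) P) (dir_deriv (e i) Q))))"
    by (rule linear_restricted_sum[OF subspace_tensors linear_restricted_omega_hat_funpow])
       (use mem in \<open>auto intro: subspace_diff[OF subspace_tensors]\<close>)
  finally have *: "?w (omega_hat n e f (tensor P Q))
      = (1/2) *\<^sub>R (\<Sum>i<n. ?w (tensor (dir_deriv (e i) P) (dir_deriv (f i) Q))
                     - ?w (tensor (dir_deriv (f i) P) (dir_deriv (e i) Q)))"
    by (simp only: diff mem scaleR_sum_right)
  show ?thesis
    by (simp add: transvectant_def funpow_swap1 * diag_mult_def fun_eq_iff scaleR_fun_def sum_fun_apply)
qed

lemma transvectant_in_hom_polys:
  assumes "P \<in> hom_polys a" "Q \<in> hom_polys b"
  shows "transvectant n e f r P Q \<in> hom_polys ((a - r) + (b - r))"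
  unfolding transvectant_def
  by (intro diag_mult_tensors omega_hat_pow_tensors tensor_in_tensors assms)

lemma transvectant_comb_left:
  assumes "P \<in> hom_polys a" "P' \<in> hom_polys a" "Q \<in> hom_polys b"
  shows "transvectant n e f r (c *\<^sub>R P + P') Q
    = c *\<^sub>R transvectant n e f r P Q + transvectant n e f r P' Q"
  using assms
proof (induction r arbitrary: a P P' b Q)
  case 0
  show ?case by (auto simp: transvectant_0 scaleR_fun_def algebra_simps)
next
  case (Suc r)
  have *: "transvectant n e f r (dir_deriv u (c *\<^sub>R P + P')) (dir_deriv v Q)
      = c *\<^sub>R transvectant n e f r (dir_deriv u P) (dir_deriv v Q)
        + transvectant n e f r (dir_deriv u P') (dir_deriv v Q)" for u v
    unfolding dir_deriv_hom_comb[OF Suc.prems(1,2)]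
    by (rule Suc.IH[OF Suc.prems[THEN dir_deriv_hom]])
  show ?case
    unfolding transvectant_Suc[OF hom_polys_comb[OF Suc.prems(1,2)] Suc.prems(3)]
      transvectant_Suc[OF Suc.prems(1,3)] transvectant_Suc[OF Suc.prems(2,3)] *
    by (rule ext) (simp add: scaleR_fun_apply sum_fun_apply sum.distrib sum_subtractf
        sum_distrib_left algebra_simps)
qed

lemma transvectant_swap:
  assumes "P \<in> hom_polys a" "Q \<in> hom_polys b"
  shows "transvectant n e f r Q P = (-1) ^ r *\<^sub>R transvectant n e f r P Q"
  using assms
proof (induction r arbitrary: a P b Q)
  case 0
  show ?case by (auto simp: transvectant_0)
next
  case (Suc r)
  have *: "transvectant n e f r (dir_deriv u Q) (dir_deriv v P)
      = (-1) ^ r *\<^sub>R transvectant n e f r (dir_deriv v P) (dir_deriv u Q)" for u v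
    by (rule Suc.IH[OF Suc.prems(1)[THEN dir_deriv_hom] Suc.prems(2)[THEN dir_deriv_hom]])
  show ?case
    unfolding transvectant_Suc[OF Suc.prems] transvectant_Suc[OF Suc.prems(2,1)] *
    by (rule ext) (simp add: scaleR_fun_apply sum_fun_apply sum_subtractf
        sum_distrib_left algebra_simps)
qed

lemma transvectant_comb_right:
  assumes "P \<in> hom_polys a" "Q \<in> hom_polys b" "Q' \<in> hom_polys b"
  shows "transvectant n e f r P (c *\<^sub>R Q + Q')
    = c *\<^sub>R transvectant n e f r P Q + transvectant n e f r P Q'"
  using assms
  by (simp add: transvectant_swap[of _ b P a] transvectant_comb_left hom_polys_comb
      scaleR_add_right mult.commute)

lemma dir_deriv_direction:
  assumes "P \<in> hom_polys m"
  shows "dir_deriv (c *\<^sub>R u + v) P = c *\<^sub>R dir_deriv u P + dir_deriv v P"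
  by (rule ext) (simp add: scaleR_fun_apply linear_add[OF linear_dir_deriv[OF assms]]
      linear_scale[OF linear_dir_deriv[OF assms]])

lemma linear_combI:
  assumes "\<And>c x y. g (c *\<^sub>R x + y) = c *\<^sub>R g x + g y"
  shows "linear g"
proof (rule linearI)
  have "g 0 = 0" using assms[of 1 0 0] by simp
  then show "g (c *\<^sub>R x) = c *\<^sub>R g x" for c x using assms[of c x 0] by simp
  show "g (x + y) = g x + g y" for x y using assms[of 1 x y] by simp
qed

lemma linear_transvectant_dir_deriv_left:
  assumes "P \<in> hom_polys a" "Q \<in> hom_polys b"
  shows "linear (\<lambda>u. transvectant n e f r (dir_deriv u P) Q)"
  by (rule linear_combI, unfold dir_deriv_direction[OF assms(1)])
     (rule transvectant_comb_left[OF dir_deriv_hom[OF assms(1)] dir_deriv_hom[OF assms(1)] assms(2)])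

lemma linear_transvectant_dir_deriv_right:
  assumes "P \<in> hom_polys a" "Q \<in> hom_polys b"
  shows "linear (\<lambda>v. transvectant n e f r P (dir_deriv v Q))"
  by (rule linear_combI, unfold dir_deriv_direction[OF assms(2)])
     (rule transvectant_comb_right[OF assms(1) dir_deriv_hom[OF assms(2)] dir_deriv_hom[OF assms(2)]])

section \<open>Invariance of transvectants\<close>

lemma finite_symplectic_basis:
  fixes e f :: "nat \<Rightarrow> 'v::real_vector"
  assumes "symplectic_basis n e f"
  obtains S where "finite S" "span S = (UNIV :: 'v set)"
  using assms that[of "e ` {..<n} \<union> f ` {..<n}"] unfolding symplectic_basis_def by blast

text \<open>The condition defining \<open>sp\<close> speaks of products of two functionals; by linearity it holds for
  every bilinear map in place of the product.\<close>

lemma sp_bilinear: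
  fixes \<beta> :: "'v::real_vector \<Rightarrow> 'v \<Rightarrow> 'u::real_vector"
  assumes "finite S" "span S = (UNIV :: 'v set)" "X \<in> sp n e f" "bilinear \<beta>"
  shows "(\<Sum>i<n. \<beta> (X (e i)) (f i) - \<beta> (X (f i)) (e i) + (\<beta> (e i) (X (f i)) - \<beta> (f i) (X (e i)))) = 0"
proof -
  obtain B \<gamma> where co: "coordinates_on (UNIV::'v set) B \<gamma>"
    using subspace_coordinates[OF subspace_UNIV assms(1)] assms(2) by blast
  note B = coordinates_onD[OF co]
  have exp: "\<beta> u v = (\<Sum>b\<in>B. \<Sum>b'\<in>B. (\<gamma> b u * \<gamma> b' v) *\<^sub>R \<beta> b b')" for u v
  proof -
    have "linear_restricted UNIV (\<lambda>u. \<beta> u v)" "linear_restricted UNIV (\<beta> b)" for b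
      using assms(4) by (simp_all add: linear_restricted_def bilinear_ladd bilinear_lmul bilinear_radd bilinear_rmul)
    note l = this[THEN linear_restricted_coordinates[OF co subspace_UNIV]]
    have "\<beta> u v = (\<Sum>b\<in>B. \<gamma> b u *\<^sub>R \<beta> b v)" by (rule l) simp
    also have "\<dots> = (\<Sum>b\<in>B. \<gamma> b u *\<^sub>R (\<Sum>b'\<in>B. \<gamma> b' v *\<^sub>R \<beta> b b'))"
      using l(2)[of v] by simp
    finally show ?thesis by (simp add: scaleR_sum_right)
  qed
  have "(\<Sum>i<n. \<gamma> b (X (e i)) * \<gamma> b' (f i) - \<gamma> b (X (f i)) * \<gamma> b' (e i)
      + (\<gamma> b (e i) * \<gamma> b' (X (f i)) - \<gamma> b (f i) * \<gamma> b' (X (e i)))) = 0" for b b'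
  proof -
    have "omega n e f (\<gamma> b \<circ> X) (\<gamma> b') + omega n e f (\<gamma> b) (\<gamma> b' \<circ> X) = 0"
      using assms(3) B(3) unfolding sp_def by blast
    then show ?thesis by (simp add: omega_def sum.distrib)
  qed
  then have "(\<Sum>b\<in>B. \<Sum>b'\<in>B. (\<Sum>i<n. \<gamma> b (X (e i)) * \<gamma> b' (f i) - \<gamma> b (X (f i)) * \<gamma> b' (e i)
      + (\<gamma> b (e i) * \<gamma> b' (X (f i)) - \<gamma> b (f i) * \<gamma> b' (X (e i)))) *\<^sub>R \<beta> b b') = 0"
    by simp
  then have "(\<Sum>i<n. \<Sum>b\<in>B. \<Sum>b'\<in>B. (\<gamma> b (X (e i)) * \<gamma> b' (f i) - \<gamma> b (X (f i)) * \<gamma> b' (e i)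
      + (\<gamma> b (e i) * \<gamma> b' (X (f i)) - \<gamma> b (f i) * \<gamma> b' (X (e i)))) *\<^sub>R \<beta> b b') = 0"
    unfolding scaleR_sum_left by (subst sum.swap, subst sum.swap[of _ B]) (simp add: sum.swap[of _ B "{..<n}"])
  moreover have "(\<Sum>i<n. \<beta> (X (e i)) (f i) - \<beta> (X (f i)) (e i) + (\<beta> (e i) (X (f i)) - \<beta> (f i) (X (e i))))
    = (\<Sum>i<n. \<Sum>b\<in>B. \<Sum>b'\<in>B. (\<gamma> b (X (e i)) * \<gamma> b' (f i) - \<gamma> b (X (f i)) * \<gamma> b' (e i)
      + (\<gamma> b (e i) * \<gamma> b' (X (f i)) - \<gamma> b (f i) * \<gamma> b' (X (e i)))) *\<^sub>R \<beta> b b')"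
    by (subst (1 2 3 4) exp) (simp only: sum.distrib sum_subtractf scaleR_add_left scaleR_diff_left)
  ultimately show ?thesis by simp
qed

text \<open>Transvectants are equivariant. In the step of the induction, moving \<open>X\<close> past the derivatives
  along \<open>e\<^sub>i\<close> and \<open>f\<^sub>i\<close> leaves derivatives along \<open>X e\<^sub>i\<close> and \<open>X f\<^sub>i\<close>, and these cancel since \<open>X\<close>
  preserves \<open>\<omega>\<close>.\<close>

lemma induced_act_transvectant:
  fixes P Q :: "'v::real_vector \<Rightarrow> real"
  assumes S: "finite S" "span S = (UNIV :: 'v set)" and X: "X \<in> sp n e f"
    and "P \<in> hom_polys a" "Q \<in> hom_polys b"
  shows "induced_act X (transvectant n e f r P Q)
    = transvectant n e f r (induced_act X P) Q + transvectant n e f r P (induced_act X Q)"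
  using assms(4,5)
proof (induction r arbitrary: a P b Q)
  case 0
  show ?case by (auto simp: transvectant_0 induced_act_mult[OF 0])
next
  case (Suc r)
  have X': "linear X" using X by (simp add: sp_def)
  let ?t = "transvectant n e f r"
  let ?d = "(a - 1 - r) + (b - 1 - r)"
  note dP = dir_deriv_hom[OF Suc.prems(1)] and dQ = dir_deriv_hom[OF Suc.prems(2)]
  have hom: "?t (dir_deriv u P) (dir_deriv v Q) \<in> hom_polys ?d" for u v
    using transvectant_in_hom_polys[OF dP dQ] .
  have lin: "linear_restricted (hom_polys ?d) (induced_act X)"
    by (simp add: linear_restricted_def induced_act_comb)
  have diff: "induced_act X (F - G) = induced_act X F - induced_act X G"
    if "F \<in> hom_polys ?d" "G \<in> hom_polys ?d" for F G
    using induced_act_comb[OF that(2,1), of X "-1"] by simp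
  let ?\<beta> = "\<lambda>u v. ?t (dir_deriv u P) (dir_deriv v Q)"
  have step: "induced_act X (?\<beta> u v)
    = ?t (dir_deriv u (induced_act X P)) (dir_deriv v Q) + ?\<beta> (X u) v
      + (?t (dir_deriv u P) (dir_deriv v (induced_act X Q)) + ?\<beta> u (X v))" for u v
  proof -
    have "?t (induced_act X (dir_deriv u P)) (dir_deriv v Q)
        = ?t (dir_deriv u (induced_act X P)) (dir_deriv v Q) + ?\<beta> (X u) v"
      using transvectant_comb_left[where c=1 and n=n and e=e and f=f and r=r,
          OF dir_deriv_hom[OF induced_act_hom[OF X' Suc.prems(1)]] dP dQ]
      by (simp add: induced_act_dir_deriv[OF X' Suc.prems(1)])
    moreover have "?t (dir_deriv u P) (induced_act X (dir_deriv v Q))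
        = ?t (dir_deriv u P) (dir_deriv v (induced_act X Q)) + ?\<beta> u (X v)"
      using transvectant_comb_right[where c=1 and n=n and e=e and f=f and r=r,
          OF dP dir_deriv_hom[OF induced_act_hom[OF X' Suc.prems(2)]] dQ]
      by (simp add: induced_act_dir_deriv[OF X' Suc.prems(2)])
    ultimately show ?thesis by (simp only: Suc.IH[OF dP dQ])
  qed
  have "bilinear ?\<beta>"
    unfolding bilinear_def using linear_transvectant_dir_deriv_left[OF Suc.prems(1) dQ]
      linear_transvectant_dir_deriv_right[OF dP Suc.prems(2)] by blast
  note z = sp_bilinear[OF S X this]
  have "induced_act X (transvectant n e f (Suc r) P Q)
    = induced_act X (\<Sum>i<n. (1/2) *\<^sub>R (?\<beta> (e i) (f i) - ?\<beta> (f i) (e i)))"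
    by (simp only: transvectant_Suc[OF Suc.prems] scaleR_sum_right)
  also have "\<dots> = (\<Sum>i<n. (1/2) *\<^sub>R induced_act X (?\<beta> (e i) (f i) - ?\<beta> (f i) (e i)))"
    by (rule linear_restricted_sum[OF subspace_hom_polys lin])
       (use hom in \<open>auto intro: subspace_diff[OF subspace_hom_polys]\<close>)
  also have "\<dots> = transvectant n e f (Suc r) (induced_act X P) Q
     + transvectant n e f (Suc r) P (induced_act X Q)
     + (1/2) *\<^sub>R (\<Sum>i<n. ?\<beta> (X (e i)) (f i) - ?\<beta> (X (f i)) (e i) + (?\<beta> (e i) (X (f i)) - ?\<beta> (f i) (X (e i))))"
    unfolding transvectant_Suc[OF induced_act_hom[OF X' Suc.prems(1)] Suc.prems(2)]
      transvectant_Suc[OF Suc.prems(1) induced_act_hom[OF X' Suc.prems(2)]]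
      diff[OF hom hom] step scaleR_add_right[symmetric] scaleR_sum_right[symmetric] sum.distrib[symmetric]
    by (intro arg_cong[where f="\<lambda>x. (1/2) *\<^sub>R x"] sum.cong) (simp_all add: algebra_simps)
  finally show ?case by (simp only: z) simp
qed

section \<open>The transvectant form\<close>

lemma power_in_hom_polys:
  "linear \<phi> \<Longrightarrow> (\<lambda>x. \<phi> x ^ m) \<in> hom_polys m"
proof (induction m)
  case 0
  then show ?case by (auto simp: hom_polys_0)
next
  case (Suc m)
  then show ?case using linear_mult_hom[of \<phi> "\<lambda>x. \<phi> x ^ m" m] by (simp add: mult.commute)
qed

lemma dir_deriv_power:
  assumes "linear \<phi>"
  shows "dir_deriv v (\<lambda>x. \<phi> x ^ Suc m) = (real (Suc m) * \<phi> v) *\<^sub>R (\<lambda>x. \<phi> x ^ m)"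
proof (rule dir_deriv_eqI)
  fix x
  have "((\<lambda>t. (\<phi> x + t * \<phi> v) ^ Suc m) has_field_derivative real (Suc m) * \<phi> v * \<phi> x ^ m) (at 0)"
    by (rule derivative_eq_intros refl)+ simp
  then show "((\<lambda>t. \<phi> (x + t *\<^sub>R v) ^ Suc m) has_field_derivative
      ((real (Suc m) * \<phi> v) *\<^sub>R (\<lambda>x. \<phi> x ^ m)) x) (at 0)"
    by (simp add: linear_add[OF assms] linear_scale[OF assms] scaleR_fun_apply)
qed

lemma transvectant_scale_right:
  assumes "P \<in> hom_polys a" "Q \<in> hom_polys b"
  shows "transvectant n e f r P (c *\<^sub>R Q) = c *\<^sub>R transvectant n e f r P Q"
  using transvectant_comb_right[where c="c - 1" and n=n and e=e and f=f and r=r, OF assms assms(2)]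
  by (simp add: scaleR_diff_left)

lemma transvectant_scale_left:
  assumes "P \<in> hom_polys a" "Q \<in> hom_polys b"
  shows "transvectant n e f r (c *\<^sub>R P) Q = c *\<^sub>R transvectant n e f r P Q"
  using transvectant_comb_left[where c="c - 1" and n=n and e=e and f=f and r=r, OF assms(1) assms]
  by (simp add: scaleR_diff_left)

text \<open>The transvectant of order \<open>r\<close> with the power \<open>\<phi>\<^sup>r\<close> of a functional is, up to a factor, the
  \<open>r\<close>-fold derivative along the vector dual to \<open>\<phi>\<close> under \<open>\<omega>\<close>.\<close>

lemma transvectant_power:
  assumes "P \<in> hom_polys a" "linear \<phi>"
  shows "transvectant n e f r P (\<lambda>x. \<phi> x ^ r)
    = (fact r / 2 ^ r) *\<^sub>R (dir_deriv (\<Sum>i<n. \<phi> (f i) *\<^sub>R e i - \<phi> (e i) *\<^sub>R f i) ^^ r) P"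
  using assms(1)
proof (induction r arbitrary: a P)
  case 0
  show ?case by (simp add: transvectant_0)
next
  case (Suc r)
  define w where "w = (\<Sum>i<n. \<phi> (f i) *\<^sub>R e i - \<phi> (e i) *\<^sub>R f i)"
  let ?Q = "\<lambda>x. \<phi> x ^ r"
  define t where "t u = transvectant n e f r (dir_deriv u P) ?Q" for u
  have lin: "linear t"
    unfolding t_def by (rule linear_transvectant_dir_deriv_left[OF Suc.prems power_in_hom_polys[OF assms(2)]])
  have scale: "transvectant n e f r (dir_deriv u P) (dir_deriv v (\<lambda>x. \<phi> x ^ Suc r))
      = (real (Suc r) * \<phi> v) *\<^sub>R t u" for u v
    unfolding dir_deriv_power[OF assms(2)] t_def
    by (rule transvectant_scale_right[OF dir_deriv_hom[OF Suc.prems] power_in_hom_polys[OF assms(2)]])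
  have "transvectant n e f (Suc r) P (\<lambda>x. \<phi> x ^ Suc r)
      = (1/2) *\<^sub>R (\<Sum>i<n. (real (Suc r) * \<phi> (f i)) *\<^sub>R t (e i) - (real (Suc r) * \<phi> (e i)) *\<^sub>R t (f i))"
    by (simp only: transvectant_Suc[OF Suc.prems power_in_hom_polys[OF assms(2)]] scale)
  also have "\<dots> = (real (Suc r) / 2) *\<^sub>R t w"
    unfolding w_def linear_sum[OF lin] linear_diff[OF lin] linear_scale[OF lin]
    by (simp only: scaleR_sum_right scaleR_diff_right scaleR_scaleR)
       (rule sum.cong, simp_all del: of_nat_Suc)
  also have "t w = (fact r / 2 ^ r) *\<^sub>R (dir_deriv w ^^ r) (dir_deriv w P)"
    unfolding t_def w_def by (rule Suc.IH[OF dir_deriv_hom[OF Suc.prems]])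
  finally show ?case
    unfolding w_def[symmetric] funpow_swap1[symmetric] by (simp add: funpow_swap1 mult.commute)
qed

text \<open>Every vector is dual to a functional, as \<open>\<omega>\<close> is nondegenerate.\<close>

lemma symplectic_dual_functional:
  fixes e f :: "nat \<Rightarrow> 'v::real_vector"
  assumes "symplectic_basis n e f"
  obtains \<phi> :: "'v \<Rightarrow> real" where "linear \<phi>" "(\<Sum>i<n. \<phi> (f i) *\<^sub>R e i - \<phi> (e i) *\<^sub>R f i) = w"
proof -
  let ?E = "e ` {..<n}" and ?F = "f ` {..<n}"
  have inj: "inj_on e {..<n}" "inj_on f {..<n}" and disj: "?E \<inter> ?F = {}"
    and ind: "independent (?E \<union> ?F)" and sp: "span (?E \<union> ?F) = UNIV"
    using assms by (simp_all add: symplectic_basis_def)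
  define c where "c = representation (?E \<union> ?F) w"
  \<comment> \<open>If \<open>w = \<Sum>\<^sub>i a\<^sub>i e\<^sub>i + b\<^sub>i f\<^sub>i\<close>, the functional with \<open>\<phi>(f\<^sub>i) = a\<^sub>i\<close> and \<open>\<phi>(e\<^sub>i) = - b\<^sub>i\<close> is the one wanted.\<close>
  define h where "h x = (if x \<in> ?E then - c (f (the_inv_into {..<n} e x))
    else c (e (the_inv_into {..<n} f x)))" for x
  obtain \<phi> :: "'v \<Rightarrow> real" where \<phi>: "linear \<phi>" "\<forall>x\<in>?E \<union> ?F. \<phi> x = h x"
    using linear_independent_extend[OF ind] by blast
  have he: "\<phi> (e i) = - c (f i)" and hf: "\<phi> (f i) = c (e i)" if "i < n" for i
    using that \<phi>(2) disj by (auto simp: h_def the_inv_into_f_f[OF inj(1)] the_inv_into_f_f[OF inj(2)])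
  have "w = (\<Sum>b\<in>?E \<union> ?F. c b *\<^sub>R b)"
    unfolding c_def by (rule sum_representation_eq[symmetric, OF ind]) (use sp in auto)
  also have "\<dots> = (\<Sum>b\<in>?E. c b *\<^sub>R b) + (\<Sum>b\<in>?F. c b *\<^sub>R b)"
    by (rule sum.union_disjoint) (use disj in auto)
  also have "\<dots> = (\<Sum>i<n. c (e i) *\<^sub>R e i) + (\<Sum>i<n. c (f i) *\<^sub>R f i)"
    by (simp add: sum.reindex inj)
  also have "\<dots> = (\<Sum>i<n. \<phi> (f i) *\<^sub>R e i - \<phi> (e i) *\<^sub>R f i)"
    by (simp add: he hf sum.distrib)
  finally show thesis using that \<phi>(1) by simp
qed

lemma transvectant_form_swap:
  assumes "P \<in> hom_polys p" "Q \<in> hom_polys p"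
  shows "transvectant_form n e f p Q P = (-1) ^ p * transvectant_form n e f p P Q"
  by (simp add: transvectant_form_def transvectant_swap[OF assms] scaleR_fun_apply)

text \<open>Pairing with \<open>\<phi>\<^sup>p\<close> evaluates \<open>P\<close>, up to the nonzero factor \<open>p!\<^sup>2 / 2\<^sup>p\<close>, at the vector dual to \<open>\<phi>\<close>.
  So a polynomial in the radical vanishes at every point.\<close>

lemma nondegenerate_transvectant_form:
  fixes e f :: "nat \<Rightarrow> 'v::real_vector"
  assumes "symplectic_basis n e f"
  shows "nondegenerate_on (hom_polys p) (transvectant_form n e f p)"
proof -
  have zero: "P = 0" if P: "P \<in> hom_polys p" and 0: "\<forall>Q\<in>hom_polys p. transvectant_form n e f p P Q = 0"
    for P :: "'v \<Rightarrow> real"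
  proof
    fix w
    obtain \<phi> :: "'v \<Rightarrow> real" where \<phi>: "linear \<phi>" "(\<Sum>i<n. \<phi> (f i) *\<^sub>R e i - \<phi> (e i) *\<^sub>R f i) = w"
      using symplectic_dual_functional[OF assms] .
    have "0 = transvectant_form n e f p P (\<lambda>x. \<phi> x ^ p)"
      using 0 power_in_hom_polys[OF \<phi>(1)] by simp
    also have "\<dots> = fact p / 2 ^ p * (fact p * P w)"
      by (simp add: transvectant_form_def transvectant_power[OF P \<phi>(1)] \<phi>(2)
          dir_deriv_funpow_self[OF P] scaleR_fun_apply)
    finally show "P w = 0 w" by simp
  qed
  then show ?thesis
    unfolding nondegenerate_on_def using transvectant_form_swap by (metis mult_zero_right)
qed

lemma bilinear_transvectant_form:
  "bilinear_on (hom_polys p) (transvectant_form n e f p)"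
  unfolding bilinear_on_def
proof (intro ballI allI conjI)
  fix x y z :: "'a \<Rightarrow> real" and a b :: real
  assume x: "x \<in> hom_polys p" and y: "y \<in> hom_polys p" and z: "z \<in> hom_polys p"
  have bY: "b *\<^sub>R y \<in> hom_polys p" using y by (rule subspace_scale[OF subspace_hom_polys])
  show "transvectant_form n e f p (a *\<^sub>R x + b *\<^sub>R y) z
      = a * transvectant_form n e f p x z + b * transvectant_form n e f p y z"
    unfolding transvectant_form_def transvectant_comb_left[OF x bY z] transvectant_scale_left[OF y z]
    by (simp add: scaleR_fun_apply)
  show "transvectant_form n e f p z (a *\<^sub>R x + b *\<^sub>R y)
      = a * transvectant_form n e f p z x + b * transvectant_form n e f p z y"
    unfolding transvectant_form_def transvectant_comb_right[OF z x bY] transvectant_scale_right[OF z y]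
    by (simp add: scaleR_fun_apply)
qed

text \<open>The transvectant of order \<open>p\<close> is a constant function, on which \<open>sp\<close> acts trivially.\<close>

lemma sp_invariant_transvectant_form:
  fixes e f :: "nat \<Rightarrow> 'v::real_vector"
  assumes "symplectic_basis n e f"
  shows "sp_invariant_form_on n e f (hom_polys p) (transvectant_form n e f p)"
  unfolding sp_invariant_form_on_def
proof (intro ballI)
  fix X and P Q :: "'v \<Rightarrow> real" assume X: "X \<in> sp n e f" and P: "P \<in> hom_polys p" and Q: "Q \<in> hom_polys p"
  obtain S :: "'v set" where S: "finite S" "span S = UNIV" using finite_symplectic_basis[OF assms] .
  have "induced_act X (transvectant n e f p P Q) = (\<lambda>_. 0)"
    unfolding transvectant_eq_const[OF P Q] by (rule induced_act_const)
  then show "transvectant_form n e f p (induced_act X P) Q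
      + transvectant_form n e f p P (induced_act X Q) = 0"
    unfolding induced_act_transvectant[OF S X P Q]
    by (simp add: transvectant_form_def fun_eq_iff)
qed

section \<open>The trace invariants\<close>

text \<open>Invariance of the trace follows from equivariance of the operator: along the direction \<open>X\<cdot>P\<close> the
  operator \<open>A\<^sub>P\<close> changes by the commutator with the action of \<open>X\<close> on \<open>S\<^sup>qV\<^sup>*\<close>.\<close>

lemma sp_invariant_trace_funpow:
  fixes e f :: "nat \<Rightarrow> 'v::real_vector" and A :: "('v \<Rightarrow> real) \<Rightarrow> ('v \<Rightarrow> real) \<Rightarrow> ('v \<Rightarrow> real)"
  assumes "symplectic_basis n e f"
    and endo: "\<And>P. P \<in> hom_polys p \<Longrightarrow> endo_on (hom_polys q) (A P)"
    and deriv: "\<And>X P \<phi> Q. X \<in> sp n e f \<Longrightarrow> P \<in> hom_polys p \<Longrightarrow> linear \<phi> \<Longrightarrow> Q \<in> hom_polys q \<Longrightarrow>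
      ((\<lambda>t. \<phi> (A (P + t *\<^sub>R induced_act X P) Q)) has_field_derivative
        \<phi> (induced_act X (A P Q) - A P (induced_act X Q))) (at 0)"
  shows "sp_invariant_on n e f (hom_polys p) (\<lambda>P. trace_on (hom_polys q) (A P ^^ k))"
  unfolding sp_invariant_on_def
proof (intro ballI)
  fix X and P :: "'v \<Rightarrow> real" assume X: "X \<in> sp n e f" and P: "P \<in> hom_polys p"
  have X': "linear X" using X by (simp add: sp_def)
  obtain S :: "'v set" where "finite S" "span S = UNIV" using finite_symplectic_basis[OF assms(1)] .
  then obtain T :: "('v \<Rightarrow> real) set" where T: "finite T" "hom_polys q \<subseteq> span T"
    by (rule finite_spanning_hom_polys)
  let ?R = "induced_act X P"
  have "endo_on (hom_polys q) (A (P + t *\<^sub>R ?R))" for t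
    by (intro endo subspace_add[OF subspace_hom_polys] subspace_scale[OF subspace_hom_polys] P
        induced_act_hom[OF X'])
  moreover have "endo_on (hom_polys q) (induced_act X)"
    by (simp add: endo_on_def linear_restricted_def induced_act_hom[OF X'] induced_act_comb)
  ultimately have "((\<lambda>t. trace_on (hom_polys q) (A (P + t *\<^sub>R ?R) ^^ k)) has_field_derivative 0) (at 0)"
    by (rule trace_funpow_deriv_zero[OF subspace_hom_polys T]) (use deriv[OF X P] in simp)
  then show "induced_act (induced_act X) (\<lambda>P. trace_on (hom_polys q) (A P ^^ k)) P = 0"
    by (simp add: induced_act_def[of "induced_act X"] dir_deriv_def DERIV_imp_deriv)
qed

lemma hom_poly_trace_funpow:
  fixes e f :: "nat \<Rightarrow> 'v::real_vector" and A :: "('v \<Rightarrow> real) \<Rightarrow> ('v \<Rightarrow> real) \<Rightarrow> ('v \<Rightarrow> real)"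
  assumes "symplectic_basis n e f"
    and endo: "\<And>P. P \<in> hom_polys p \<Longrightarrow> endo_on (hom_polys q) (A P)"
    and entry: "\<And>\<phi> Q. linear \<phi> \<Longrightarrow> Q \<in> hom_polys q \<Longrightarrow> hom_poly_on (hom_polys p) d (\<lambda>P. \<phi> (A P Q))"
  shows "hom_poly_on (hom_polys p) (d * k) (\<lambda>P. trace_on (hom_polys q) (A P ^^ k))"
proof -
  obtain S :: "'v set" where "finite S" "span S = UNIV" using finite_symplectic_basis[OF assms(1)] .
  then obtain T :: "('v \<Rightarrow> real) set" where T: "finite T" "hom_polys q \<subseteq> span T"
    by (rule finite_spanning_hom_polys)
  show ?thesis
    by (rule hom_poly_on_trace_funpow[OF subspace_hom_polys T]) (simp_all add: endo entry)
qed

lemma endo_on_A_half: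
  assumes "even p" "p \<le> 2 * q" "P \<in> hom_polys p"
  shows "endo_on (hom_polys q) (A_half n e f p P)"
  using assms
  by (simp add: endo_on_def linear_restricted_def A_half_hom) (simp add: A_half_def transvectant_comb_right)

lemma endo_on_A_l:
  assumes "p \<le> q + 2 * l" "2 * l \<le> p" "P \<in> hom_polys p"
  shows "endo_on (hom_polys q) (A_l n e f p l P)"
  using assms transvectant_comb_right[OF transvectant_in_hom_polys[OF assms(3,3)]]
  by (simp add: endo_on_def linear_restricted_def A_l_hom) (simp add: A_l_def)

lemma J_inv_properties:
  fixes e f :: "nat \<Rightarrow> 'v::real_vector"
  assumes sb: "symplectic_basis n e f" and pq: "even p" "p \<le> 2 * q"
  shows "hom_poly_on (hom_polys p) k (J_inv n e f p q k)"
    and "sp_invariant_on n e f (hom_polys p) (J_inv n e f p q k)"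
proof -
  let ?t = "transvectant n e f (p div 2)"
  obtain S :: "'v set" where S: "finite S" "span S = UNIV" using finite_symplectic_basis[OF sb] .
  obtain T :: "('v \<Rightarrow> real) set" where T: "finite T" "hom_polys p \<subseteq> span T"
    using finite_spanning_hom_polys[OF S] .
  have entry: "hom_poly_on (hom_polys p) 1 (\<lambda>P. \<phi> (A_half n e f p P Q))"
    if "linear \<phi>" "Q \<in> hom_polys q" for \<phi> Q
    unfolding A_half_def using that
    by (intro hom_poly_on_linear_restricted[OF subspace_hom_polys T])
       (simp add: linear_restricted_def transvectant_comb_left linear_add linear_scale)
  have "hom_poly_on (hom_polys p) (1 * k) (\<lambda>P. trace_on (hom_polys q) (A_half n e f p P ^^ k))"
    by (rule hom_poly_trace_funpow[OF sb]) (rule endo_on_A_half[OF pq] entry; assumption)+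
  then show "hom_poly_on (hom_polys p) k (J_inv n e f p q k)"
    by (simp add: J_inv_def[abs_def])
  have deriv: "((\<lambda>t. \<phi> (A_half n e f p (P + t *\<^sub>R induced_act X P) Q)) has_field_derivative
        \<phi> (induced_act X (A_half n e f p P Q) - A_half n e f p P (induced_act X Q))) (at 0)"
    if X: "X \<in> sp n e f" and P: "P \<in> hom_polys p" and \<phi>: "linear \<phi>" and Q: "Q \<in> hom_polys q" for X P \<phi> Q
  proof -
    have R: "induced_act X P \<in> hom_polys p" using X P by (simp add: sp_def induced_act_hom)
    have "\<phi> (?t (P + t *\<^sub>R induced_act X P) Q) = t * \<phi> (?t (induced_act X P) Q) + \<phi> (?t P Q)" for t
      unfolding add.commute[of P] transvectant_comb_left[OF R P Q]
      by (simp only: linear_add[OF \<phi>] linear_scale[OF \<phi>] real_scaleR_def)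
    moreover have "induced_act X (?t P Q) - ?t P (induced_act X Q) = ?t (induced_act X P) Q"
      by (simp only: induced_act_transvectant[OF S X P Q] add_diff_cancel_right')
    ultimately show ?thesis unfolding A_half_def
      by (auto intro!: derivative_eq_intros)
  qed
  show "sp_invariant_on n e f (hom_polys p) (J_inv n e f p q k)"
    unfolding J_inv_def[abs_def]
    by (rule sp_invariant_trace_funpow[OF sb]) (rule endo_on_A_half[OF pq] deriv; assumption)+
qed

lemma I_inv_properties:
  fixes e f :: "nat \<Rightarrow> 'v::real_vector"
  assumes sb: "symplectic_basis n e f" and pq: "p \<le> q + 2 * l" "2 * l \<le> p"
  shows "hom_poly_on (hom_polys p) (2 * k) (I_inv n e f p q l k)"
    and "sp_invariant_on n e f (hom_polys p) (I_inv n e f p q l k)"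
proof -
  let ?t = "transvectant n e f (2 * l)" and ?s = "transvectant n e f (p - 2 * l)"
  let ?d = "(p - 2 * l) + (p - 2 * l)"
  obtain S :: "'v set" where S: "finite S" "span S = UNIV" using finite_symplectic_basis[OF sb] .
  obtain T :: "('v \<Rightarrow> real) set" where T: "finite T" "hom_polys p \<subseteq> span T"
    using finite_spanning_hom_polys[OF S] .
  have tm: "?t P P' \<in> hom_polys ?d" if "P \<in> hom_polys p" "P' \<in> hom_polys p" for P P'
    using transvectant_in_hom_polys[OF that] .
  have \<phi>s: "\<phi> (?s (c *\<^sub>R F + G) Q) = c * \<phi> (?s F Q) + \<phi> (?s G Q)"
    if "linear \<phi>" "Q \<in> hom_polys q" "F \<in> hom_polys ?d" "G \<in> hom_polys ?d"
    for \<phi> :: "('v \<Rightarrow> real) \<Rightarrow> real" and c F G Q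
    unfolding transvectant_comb_left[OF that(3,4,2)]
    by (simp only: linear_add[OF that(1)] linear_scale[OF that(1)] real_scaleR_def)
  have entry: "hom_poly_on (hom_polys p) 2 (\<lambda>P. \<phi> (A_l n e f p l P Q))"
    if "linear \<phi>" "Q \<in> hom_polys q" for \<phi> Q
    unfolding A_l_def
    by (intro hom_poly_on_quadratic[OF subspace_hom_polys T])
       (simp_all add: linear_restricted_def transvectant_comb_left[where a=p and b=p]
          transvectant_comb_right[where a=p and b=p] \<phi>s[OF that] tm)
  show "hom_poly_on (hom_polys p) (2 * k) (I_inv n e f p q l k)"
    unfolding I_inv_def[abs_def] by (rule hom_poly_trace_funpow[OF sb]) (rule endo_on_A_l[OF pq] entry; assumption)+
  have deriv: "((\<lambda>t. \<phi> (A_l n e f p l (P + t *\<^sub>R induced_act X P) Q)) has_field_derivative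
        \<phi> (induced_act X (A_l n e f p l P Q) - A_l n e f p l P (induced_act X Q))) (at 0)"
    if X: "X \<in> sp n e f" and P: "P \<in> hom_polys p" and \<phi>: "linear \<phi>" and Q: "Q \<in> hom_polys q" for X P \<phi> Q
  proof -
    define R where "R = induced_act X P"
    have R: "R \<in> hom_polys p" unfolding R_def using X P by (simp add: sp_def induced_act_hom)
    let ?M = "\<lambda>F. \<phi> (?s F Q)"
    \<comment> \<open>\<open>A_l\<close> is quadratic in \<open>P\<close>; only the two mixed terms survive in the derivative.\<close>
    have "?M (?t (P + t *\<^sub>R R) (P + t *\<^sub>R R))
        = t * (t * ?M (?t R R) + ?M (?t R P)) + (t * ?M (?t P R) + ?M (?t P P))" for t
    proof -
      have PR: "t *\<^sub>R R + P \<in> hom_polys p" by (rule hom_polys_comb[OF R P])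
      show ?thesis
        unfolding add.commute[of P] transvectant_comb_left[OF R P PR]
          transvectant_comb_right[OF R R P] transvectant_comb_right[OF P R P]
          \<phi>s[OF \<phi> Q hom_polys_comb[OF tm[OF R R] tm[OF R P]] hom_polys_comb[OF tm[OF P R] tm[OF P P]]]
          \<phi>s[OF \<phi> Q tm[OF R R] tm[OF R P]] \<phi>s[OF \<phi> Q tm[OF P R] tm[OF P P]] ..
    qed
    moreover have "\<phi> (induced_act X (?s (?t P P) Q) - ?s (?t P P) (induced_act X Q))
        = ?M (?t R P) + ?M (?t P R)"
      using \<phi>s[OF \<phi> Q tm[OF R P] tm[OF P R], of 1]
      by (simp only: induced_act_transvectant[OF S X tm[OF P P] Q] add_diff_cancel_right'
          induced_act_transvectant[OF S X P P] R_def[symmetric] scaleR_one mult_1_left)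
    ultimately show ?thesis unfolding A_l_def R_def[symmetric]
      by (auto intro!: derivative_eq_intros)
  qed
  show "sp_invariant_on n e f (hom_polys p) (I_inv n e f p q l k)"
    unfolding I_inv_def[abs_def]
    by (rule sp_invariant_trace_funpow[OF sb]) (rule endo_on_A_l[OF pq] deriv; assumption)+
qed

lemma hom_poly_on_imp_poly_upto_on:
  "hom_poly_on W a F \<Longrightarrow> a \<le> d \<Longrightarrow> poly_upto_on W d F"
  unfolding hom_poly_on_def poly_upto_on_def polys_upto_def
  by (erule bexE, rule bexI, assumption) (auto intro: span_base)

theorem theorem5:
  fixes e f :: "nat \<Rightarrow> 'v::real_vector" and n p q :: nat
  assumes "symplectic_basis n e f" and "p > 0" and "q > 0"
  shows
    "(\<forall>l k. p \<le> q + 2 * l \<and> 2 * l \<le> p \<and> 1 \<le> k \<and> k \<le> (2 * n + q - 1) choose q \<longrightarrow>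
        hom_poly_on (hom_polys p) (2 * k) (I_inv n e f p q l k) \<and>
        sp_invariant_on n e f (hom_polys p) (I_inv n e f p q l k)) \<and>
     (even p \<longrightarrow> (\<forall>k. p \<le> 2 * q \<and> 1 \<le> k \<and> k \<le> (2 * n + q - 1) choose q \<longrightarrow>
        hom_poly_on (hom_polys p) k (J_inv n e f p q k) \<and>
        poly_upto_on (hom_polys p) (2 * k) (J_inv n e f p q k) \<and>
        sp_invariant_on n e f (hom_polys p) (J_inv n e f p q k))) \<and>
     bilinear_on (hom_polys p) (transvectant_form n e f p) \<and>
     nondegenerate_on (hom_polys p) (transvectant_form n e f p) \<and>
     sp_invariant_form_on n e f (hom_polys p) (transvectant_form n e f p) \<and>
     (odd p \<longrightarrow> skew_symmetric_on (hom_polys p) (transvectant_form n e f p)) \<and>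
     (even p \<longrightarrow> symmetric_on (hom_polys p) (transvectant_form n e f p))"
proof -
  have "symmetric_on (hom_polys p) (transvectant_form n e f p)" if "even p"
    unfolding symmetric_on_def
    by (intro ballI, subst transvectant_form_swap) (simp_all add: that)
  moreover have "skew_symmetric_on (hom_polys p) (transvectant_form n e f p)" if "odd p"
    unfolding skew_symmetric_on_def
    by (intro ballI, subst transvectant_form_swap) (simp_all add: that)
  moreover have "poly_upto_on (hom_polys p) (2 * k) (J_inv n e f p q k)"
    if "even p" "p \<le> 2 * q" for k
    by (rule hom_poly_on_imp_poly_upto_on[OF J_inv_properties(1)[OF assms(1) that]]) simp
  ultimately show ?thesis
    by (intro conjI impI allI)
       (simp_all add: I_inv_properties[OF assms(1)] J_inv_properties[OF assms(1)]
          bilinear_transvectant_form nondegenerate_transvectant_form[OF assms(1)]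
          sp_invariant_transvectant_form[OF assms(1)])
qed

end
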